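(* Let $N,P\ge2$ be integers and $\lambda,\tau>0$. Let $A:=(D_{\rm m}\,|\,D_{\rm f})$ with $D_{\rm f}=D_P^{T}\otimes I_N$ and $D_{\rm m}=I_P\otimes D_N^{T}$ (mirror boundary) or $D_{\rm m}=I_P\otimes(D_N^{\rm per})^{T}$ (periodic boundary). Let $S_{n-1}$, $C_n$, $F_n$, $\mathrm d^{\rm zero}_{n-1}$, $\mathrm d^{\rm mirr}_n$, $\mathrm d^{\rm per}_n$ be as in the context. Then the inverse of $\lambda A^{T}A+\frac1\tau I$ is $$\begin{pmatrix}I&-X^{-1}Y\\0&I\end{pmatrix}\begin{pmatrix}X^{-1}&0\\0&S^{-1}\end{pmatrix}\begin{pmatrix}I&0\\-Y^{T}X^{-1}&I\end{pmatrix},$$ where (i) for mirror boundary conditions $$Y=\lambda\,D_P^{T}\otimes D_N,\qquad X^{-1}=I_P\otimes S_{N-1}\,\mathrm{diag}\big(\lambda N^2\mathrm d^{\rm zero}_{N-1}+\tfrac1\tau\big)^{-1}S_{N-1},$$ $$S^{-1}=(S_{P-1}\otimes C_N^{T})\,\mathrm{diag}\Big(\lambda P^2\mathrm d^{\rm zero}_{P-1}\otimes(1+\tau\lambda N^2\mathrm d^{\rm mirr}_N)^{-1}+\tfrac1\tau\Big)^{-1}(S_{P-1}\otimes C_N);$$ (ii) for periodic boundary conditions $$Y=\lambda\,D_P^{T}\otimes D_N^{\rm per},\qquad X^{-1}=I_P\otimes F_N\,\mathrm{diag}\big(\lambda N^2\mathrm d^{\rm per}_N+\tfrac1\tau\big)^{-1}\bar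 F_N,$$ $$S^{-1}=(S_{P-1}\otimes F_N)\,\mathrm{diag}\Big(\lambda P^2\mathrm d^{\rm zero}_{P-1}\otimes(1+\tau\lambda N^2\mathrm d^{\rm per}_N)^{-1}+\tfrac1\tau\Big)^{-1}(S_{P-1}\otimes\bar F_N).$$
   Context: For $n\ge2$: $D_n\in\mathbb R^{n-1,n}$ is defined by $(D_nx)_j=n(x_{j+1}-x_j)$, $j=1,\dots,n-1$; $D_n^{\rm per}\in\mathbb R^{n,n}$ is defined by $(D_n^{\rm per}x)_1=n(x_1-x_n)$ and $(D_n^{\rm per}x)_j=n(x_j-x_{j-1})$, $j=2,\dots,n$. $I_n$ (or $I$, when the size is clear) is the identity matrix and $\otimes$ the Kronecker product, $A\otimes B=(a_{ij}B)_{i,j}$ (also for column vectors). The block form is with respect to the column splitting of $A$ into $D_{\rm m}$ and $D_{\rm f}$. The sine matrix is $S_{n-1}:=\sqrt{\tfrac2n}\left(\sin\frac{jk\pi}{n}\right)_{j,k=1}^{n-1}$ (the symbol $S$ without index denotes a different matrix, specified through $S^{-1}$ in the claim). The cosine matrix is $C_n:=\sqrt{\tfrac2n}\left(\epsilon_j\cos\frac{j(2k+1)\pi}{2n}\right)_{j,k=0}^{n-1}$ with $\epsilon_0:=1/\sqrt2$, $\epsilon_j:=1$ for $j\ge1$. The Fourier matrix is $F_n:=\sqrt{\tfrac1n}\left(e^{-2\pi i jk/n}\right)_{j,k=0}^{n-1}$, with entrywise conjugate $\bar F_n$. Further $\mathrm d^{\rm zero}_{n-1}:=\left(4\sin^2\frac{k\pi}{2n}\right)_{k=1}^{n-1}$,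 $\mathrm d^{\rm mirr}_n:=\left(4\sin^2\frac{k\pi}{2n}\right)_{k=0}^{n-1}$, $\mathrm d^{\rm per}_n:=\left(4\sin^2\frac{k\pi}{n}\right)_{k=0}^{n-1}$. For a vector $a$, $\mathrm{diag}(a)$ is the diagonal matrix with diagonal $a$; adding a scalar to a vector and inverting a vector, as in $(1+\tau\lambda N^2\mathrm d)^{-1}$, are meant componentwise. *)

theory Defs
  imports Complex_Main "Jordan_Normal_Form.Gauss_Jordan_Elimination"
begin

text \<open>Rows, columns and vector entries are numbered from \<open>0\<close>, so an entry of a matrix whose
  customary numbering starts at \<open>1\<close> appears with both indices increased by one in its formula.\<close>

definition kron_mat :: "'a::times mat \<Rightarrow> 'a mat \<Rightarrow> 'a mat" (infixl "\<otimes>\<^sub>m" 75) where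
  "A \<otimes>\<^sub>m B = mat (dim_row A * dim_row B) (dim_col A * dim_col B)
     (\<lambda>(i, j). A $$ (i div dim_row B, j div dim_col B) * B $$ (i mod dim_row B, j mod dim_col B))"

definition kron_vec :: "'a::times vec \<Rightarrow> 'a vec \<Rightarrow> 'a vec" (infixl "\<otimes>\<^sub>v" 75) where
  "a \<otimes>\<^sub>v b = vec (dim_vec a * dim_vec b) (\<lambda>i. a $ (i div dim_vec b) * b $ (i mod dim_vec b))"

definition beside_mat :: "'a mat \<Rightarrow> 'a mat \<Rightarrow> 'a mat" where
  "beside_mat A B = mat (dim_row A) (dim_col A + dim_col B)
     (\<lambda>(i, j). if j < dim_col A then A $$ (i, j) else B $$ (i, j - dim_col A))"

definition shift_vec :: "'a::plus \<Rightarrow> 'a vec \<Rightarrow> 'a vec" where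
  "shift_vec c v = map_vec (\<lambda>x. c + x) v"

definition inv_vec :: "'a::inverse vec \<Rightarrow> 'a vec" where
  "inv_vec v = map_vec inverse v"

definition diag_of_vec :: "'a::zero vec \<Rightarrow> 'a mat" where
  "diag_of_vec v = mat_diag (dim_vec v) (\<lambda>i. v $ i)"

text \<open>Meaningful only for invertible matrices, as \<open>mat_inverse\<close> returns \<open>None\<close> otherwise.\<close>

definition inv_mat :: "'a::field mat \<Rightarrow> 'a mat" where
  "inv_mat A = the (mat_inverse A)"

abbreviation complex_mat :: "real mat \<Rightarrow> complex mat" where
  "complex_mat \<equiv> map_mat complex_of_real"

definition diff_mat :: "nat \<Rightarrow> real mat" where
  "diff_mat n = mat (n - 1) n
     (\<lambda>(j, k). if k = j + 1 then real n else if k = j then - real n else 0)"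

definition diff_per_mat :: "nat \<Rightarrow> real mat" where
  "diff_per_mat n = mat n n
     (\<lambda>(j, k). if k = j then real n
               else if k = (if j = 0 then n - 1 else j - 1) then - real n else 0)"

lemma diff_mat_mult_vec:
  assumes "x \<in> carrier_vec n" "j < n - 1"
  shows "(diff_mat n *\<^sub>v x) $ j = real n * (x $ (j + 1) - x $ j)"
proof -
  have "(diff_mat n *\<^sub>v x) $ j
      = (\<Sum>k<n. (if k = j + 1 then real n else if k = j then - real n else 0) * x $ k)"
    using assms by (auto simp: diff_mat_def scalar_prod_def lessThan_atLeast0 intro!: sum.cong)
  also have "\<dots> = (\<Sum>k<n. (if k = j + 1 then real n * x $ k else 0) + (if k = j then - real n * x $ k else 0))"
    by (intro sum.cong) auto
  also have "\<dots> = real n * (x $ (j + 1) - x $ j)"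
    using assms by (auto simp: sum.distrib sum.delta algebra_simps)
  finally show ?thesis .
qed

lemma diff_per_mat_mult_vec:
  assumes "n \<ge> 2" "x \<in> carrier_vec n" "j < n"
  shows "(diff_per_mat n *\<^sub>v x) $ j = real n * (x $ j - x $ (if j = 0 then n - 1 else j - 1))"
proof -
  define p where "p = (if j = 0 then n - 1 else j - 1)"
  have p: "p < n" "p \<noteq> j"
    using assms by (auto simp: p_def)
  have "(diff_per_mat n *\<^sub>v x) $ j
      = (\<Sum>k<n. (if k = j then real n else if k = p then - real n else 0) * x $ k)"
    using assms
    by (auto simp: diff_per_mat_def scalar_prod_def lessThan_atLeast0 p_def intro!: sum.cong)
  also have "\<dots> = (\<Sum>k<n. (if k = j then real n * x $ k else 0) + (if k = p then - real n * x $ k else 0))"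
    using p by (intro sum.cong) auto
  also have "\<dots> = real n * (x $ j - x $ p)"
    using assms p by (auto simp: sum.distrib sum.delta algebra_simps)
  finally show ?thesis
    by (simp add: p_def)
qed

text \<open>The argument \<open>n\<close> of \<open>sine_mat\<close> and \<open>d_zero\<close> is the one in the denominators; the size is
  \<open>n - 1\<close>.\<close>

definition sine_mat :: "nat \<Rightarrow> real mat" where
  "sine_mat n = mat (n - 1) (n - 1)
     (\<lambda>(j, k). sqrt (2 / real n) * sin (real ((j + 1) * (k + 1)) * pi / real n))"

definition cosine_mat :: "nat \<Rightarrow> real mat" where
  "cosine_mat n = mat n n
     (\<lambda>(j, k). sqrt (2 / real n) *
        ((if j = 0 then 1 / sqrt 2 else 1) * cos (real (j * (2 * k + 1)) * pi / (2 * real n))))"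

definition fourier_mat :: "nat \<Rightarrow> complex mat" where
  "fourier_mat n = mat n n
     (\<lambda>(j, k). complex_of_real (sqrt (1 / real n)) *
        exp (- 2 * complex_of_real pi * \<i> * of_nat (j * k) / of_nat n))"

definition d_zero :: "nat \<Rightarrow> real vec" where
  "d_zero n = vec (n - 1) (\<lambda>k. 4 * (sin (real (k + 1) * pi / (2 * real n)))\<^sup>2)"

definition d_mirr :: "nat \<Rightarrow> real vec" where
  "d_mirr n = vec n (\<lambda>k. 4 * (sin (real k * pi / (2 * real n)))\<^sup>2)"

definition d_per :: "nat \<Rightarrow> real vec" where
  "d_per n = vec n (\<lambda>k. 4 * (sin (real k * pi / real n))\<^sup>2)"

text \<open>The arguments \<open>Xi\<close> and \<open>Si\<close> stand for \<open>X\<^sup>-\<^sup>1\<close> and \<open>S\<^sup>-\<^sup>1\<close>.\<close>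

definition block_product :: "'a::ring_1 mat \<Rightarrow> 'a mat \<Rightarrow> 'a mat \<Rightarrow> 'a mat" where
  "block_product Xi Y Si =
     (let p = dim_row Y; q = dim_col Y in
        four_block_mat (1\<^sub>m p) (- (Xi * Y)) (0\<^sub>m q p) (1\<^sub>m q)
      * four_block_mat Xi (0\<^sub>m p q) (0\<^sub>m q p) Si
      * four_block_mat (1\<^sub>m p) (0\<^sub>m p q) (- (transpose_mat Y * Xi)) (1\<^sub>m q))"

end

theory Submission
  imports Defs "Jordan_Normal_Form.Determinant"
begin

text \<open>In block form \<open>\<lambda>A\<^sup>TA + I/\<tau>\<close> has the diagonal blocks \<open>X = I \<otimes> (\<lambda>DD\<^sup>T + I/\<tau>)\<close> and
  \<open>\<lambda>EE\<^sup>T \<otimes> I + I/\<tau>\<close> and the off-diagonal block \<open>Y = \<lambda>E\<^sup>T \<otimes> D\<close>, where \<open>E = D\<^sub>P\<close> and \<open>D\<close> is \<open>D\<^sub>N\<close>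
  or its periodic variant. The claimed product is the block inverse through the Schur complement
  \<open>S\<close> of \<open>X\<close>. Since \<open>I - \<lambda>D\<^sup>T(\<lambda>DD\<^sup>T + I/\<tau>)\<^sup>-\<^sup>1D = (I + \<tau>\<lambda>D\<^sup>TD)\<^sup>-\<^sup>1\<close>, this Schur complement is
  \<open>\<lambda>EE\<^sup>T \<otimes> (I + \<tau>\<lambda>D\<^sup>TD)\<^sup>-\<^sup>1 + I/\<tau>\<close>, so it is diagonalised by the Kronecker product of bases
  diagonalising \<open>EE\<^sup>T\<close> and \<open>D\<^sup>TD\<close>. These are the sine, cosine and Fourier bases, because the three
  Gram matrices are discrete Laplacians with Dirichlet, Neumann and periodic boundary.\<close>

subsection \<open>Kronecker products and diagonal matrices\<close>

lemma dim_mat_diag [simp]: "dim_row (mat_diag n f) = n" "dim_col (mat_diag n f) = n"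
  by (simp_all add: mat_diag_def)

text \<open>The range below \<open>a * b\<close> consists of \<open>a\<close> consecutive blocks of
  length \<open>b\<close>, with \<open>k div b\<close> the block and \<open>k mod b\<close> the
  position in it. This turns the single inner index of a product of Kronecker products into a
  pair.\<close>

lemma sum_div_mod:
  fixes f :: "nat \<Rightarrow> nat \<Rightarrow> 'a::comm_monoid_add"
  shows "(\<Sum>k<a * b. f (k div b) (k mod b)) = (\<Sum>i<a. \<Sum>j<b. f i j)"
proof (cases "b = 0")
  case False
  have "(\<Sum>i<a. \<Sum>j<b. f i j) = (\<Sum>i<a. \<Sum>k\<in>{i * b..<i * b + b}. f (k div b) (k mod b))"
  proof (rule sum.cong[OF refl])
    fix i
    have "(\<Sum>k\<in>{i * b..<i * b + b}. f (k div b) (k mod b))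
        = (\<Sum>j\<in>{0..<b}. f ((j + i * b) div b) ((j + i * b) mod b))"
      using sum.shift_bounds_nat_ivl[of "\<lambda>k. f (k div b) (k mod b)" 0 "i * b" b]
      by (simp add: add.commute)
    also have "\<dots> = (\<Sum>j<b. f i j)"
      by (simp add: lessThan_atLeast0)
    finally show "(\<Sum>j<b. f i j) = (\<Sum>k\<in>{i * b..<i * b + b}. f (k div b) (k mod b))" ..
  qed
  also have "\<dots> = (\<Sum>k<a * b. f (k div b) (k mod b))"
    by (rule sum.nat_group)
  finally show ?thesis ..
qed simp

lemma div_mult_less: "i div b < a" if "i < a * b" for i a b :: nat
  using that by (simp add: less_mult_imp_div_less)

lemma mod_mult_less: "i mod b < b" if "i < a * b" for i a b :: nat
  using that by (cases "b = 0") auto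

lemma dim_kron_mat [simp]:
  "dim_row (A \<otimes>\<^sub>m B) = dim_row A * dim_row B"
  "dim_col (A \<otimes>\<^sub>m B) = dim_col A * dim_col B"
  by (simp_all add: kron_mat_def)

lemma kron_mat_carrier [intro, simp]:
  "A \<in> carrier_mat a b \<Longrightarrow> B \<in> carrier_mat c d \<Longrightarrow> A \<otimes>\<^sub>m B \<in> carrier_mat (a * c) (b * d)"
  by (intro carrier_matI) auto

lemma index_kron_mat:
  "i < dim_row A * dim_row B \<Longrightarrow> j < dim_col A * dim_col B \<Longrightarrow>
   (A \<otimes>\<^sub>m B) $$ (i, j)
     = A $$ (i div dim_row B, j div dim_col B) * B $$ (i mod dim_row B, j mod dim_col B)"
  by (simp add: kron_mat_def)

text \<open>The mixed-product rule: once the inner index is split into a pair, the double sum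
  factors into the two separate matrix products.\<close>

lemma kron_mat_mult:
  fixes A B C D :: "'a::comm_semiring_0 mat"
  assumes "dim_col A = dim_row C" "dim_col B = dim_row D"
  shows "(A \<otimes>\<^sub>m B) * (C \<otimes>\<^sub>m D) = (A * C) \<otimes>\<^sub>m (B * D)"
proof (rule eq_matI)
  fix i j
  assume "i < dim_row ((A * C) \<otimes>\<^sub>m (B * D))" "j < dim_col ((A * C) \<otimes>\<^sub>m (B * D))"
  then have ij: "i < dim_row A * dim_row B" "j < dim_col C * dim_col D"
    by auto
  let ?r = "dim_row B" and ?s = "dim_col D" and ?m = "dim_row D"
  have "((A \<otimes>\<^sub>m B) * (C \<otimes>\<^sub>m D)) $$ (i, j)
      = (\<Sum>k<dim_row C * ?m. (A \<otimes>\<^sub>m B) $$ (i, k) * (C \<otimes>\<^sub>m D) $$ (k, j))"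
    using ij assms by (simp add: scalar_prod_def lessThan_atLeast0)
  also have "\<dots> = (\<Sum>k<dim_row C * ?m. (A $$ (i div ?r, k div ?m) * B $$ (i mod ?r, k mod ?m))
      * (C $$ (k div ?m, j div ?s) * D $$ (k mod ?m, j mod ?s)))"
    using ij assms by (intro sum.cong) (auto simp: index_kron_mat)
  also have "\<dots> = (\<Sum>k<dim_row C. \<Sum>l<?m. (A $$ (i div ?r, k) * B $$ (i mod ?r, l))
      * (C $$ (k, j div ?s) * D $$ (l, j mod ?s)))"
    by (rule sum_div_mod)
  also have "\<dots> = (\<Sum>k<dim_row C. A $$ (i div ?r, k) * C $$ (k, j div ?s))
      * (\<Sum>l<?m. B $$ (i mod ?r, l) * D $$ (l, j mod ?s))"
    by (simp add: sum_product ac_simps)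
  also have "\<dots> = ((A * C) \<otimes>\<^sub>m (B * D)) $$ (i, j)"
    using ij assms div_mult_less[OF ij(1)] mod_mult_less[OF ij(1)]
      div_mult_less[OF ij(2)] mod_mult_less[OF ij(2)]
    by (simp add: index_kron_mat scalar_prod_def lessThan_atLeast0)
  finally show "((A \<otimes>\<^sub>m B) * (C \<otimes>\<^sub>m D)) $$ (i, j) = ((A * C) \<otimes>\<^sub>m (B * D)) $$ (i, j)" .
qed auto

lemma transpose_kron_mat: "transpose_mat (A \<otimes>\<^sub>m B) = transpose_mat A \<otimes>\<^sub>m transpose_mat B"
  by (rule eq_matI) (auto simp: index_kron_mat div_mult_less mod_mult_less)

lemma div_mod_eq_iff: "i div b = j div b \<and> i mod b = j mod b \<longleftrightarrow> i = j" for i j b :: nat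
  by (metis div_mult_mod_eq)

lemma kron_mat_diag:
  fixes f g :: "nat \<Rightarrow> 'a::mult_zero"
  shows "mat_diag a f \<otimes>\<^sub>m mat_diag b g = mat_diag (a * b) (\<lambda>i. f (i div b) * g (i mod b))"
proof (rule eq_matI)
  fix i j
  assume "i < dim_row (mat_diag (a * b) (\<lambda>i. f (i div b) * g (i mod b)))"
    "j < dim_col (mat_diag (a * b) (\<lambda>i. f (i div b) * g (i mod b)))"
  then have ij: "i < a * b" "j < a * b"
    by (auto simp: mat_diag_def)
  then show "(mat_diag a f \<otimes>\<^sub>m mat_diag b g) $$ (i, j)
      = mat_diag (a * b) (\<lambda>i. f (i div b) * g (i mod b)) $$ (i, j)"
    using div_mult_less[OF ij(1)] mod_mult_less[OF ij(1)] div_mult_less[OF ij(2)]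
      mod_mult_less[OF ij(2)] div_mod_eq_iff[of i b j]
    by (auto simp: mat_diag_def index_kron_mat)
qed (auto simp: mat_diag_def)

lemma kron_mat_one:
  "1\<^sub>m a \<otimes>\<^sub>m 1\<^sub>m b = (1\<^sub>m (a * b) :: 'a::semiring_1 mat)"
  using kron_mat_diag[of a "\<lambda>_. 1::'a" b "\<lambda>_. 1"] by simp

lemma kron_mat_add_right:
  fixes A B C :: "'a::semiring mat"
  assumes "B \<in> carrier_mat r s" "C \<in> carrier_mat r s"
  shows "A \<otimes>\<^sub>m (B + C) = A \<otimes>\<^sub>m B + A \<otimes>\<^sub>m C"
  using assms by (intro eq_matI) (auto simp: index_kron_mat div_mult_less mod_mult_less algebra_simps)

lemma kron_mat_smult_right:
  fixes A B :: "'a::comm_semiring_0 mat"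
  shows "A \<otimes>\<^sub>m (c \<cdot>\<^sub>m B) = c \<cdot>\<^sub>m (A \<otimes>\<^sub>m B)"
  by (intro eq_matI) (auto simp: index_kron_mat div_mult_less mod_mult_less ac_simps)

section \<open>Embedding of real matrices into complex ones\<close>

lemma complex_mat_kron:
  "complex_mat (A \<otimes>\<^sub>m B) = complex_mat A \<otimes>\<^sub>m complex_mat B"
  by (rule eq_matI) (auto simp: index_kron_mat div_mult_less mod_mult_less)

lemma complex_mat_mult:
  "dim_col A = dim_row B \<Longrightarrow> complex_mat (A * B) = complex_mat A * complex_mat B"
  by (rule eq_matI) (auto simp: scalar_prod_def)

lemma complex_mat_add:
  "dim_row A = dim_row B \<Longrightarrow> dim_col A = dim_col B \<Longrightarrow>
   complex_mat (A + B) = complex_mat A + complex_mat B"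
  by (rule eq_matI) auto

lemma complex_mat_smult: "complex_mat (c \<cdot>\<^sub>m A) = complex_of_real c \<cdot>\<^sub>m complex_mat A"
  by (rule eq_matI) auto

lemma complex_mat_diag: "complex_mat (mat_diag n f) = mat_diag n (\<lambda>i. complex_of_real (f i))"
  by (rule eq_matI) (auto simp: mat_diag_def)

lemma complex_mat_beside:
  "dim_row A = dim_row B \<Longrightarrow>
   complex_mat (beside_mat A B) = beside_mat (complex_mat A) (complex_mat B)"
  by (rule eq_matI) (auto simp: beside_mat_def)

section \<open>Inverses of diagonal and diagonalised matrices\<close>

lemma mat_inverse_eqI:
  fixes A B :: "'a::field mat"
  assumes A: "A \<in> carrier_mat n n" and B: "B \<in> carrier_mat n n" and AB: "A * B = 1\<^sub>m n"
  shows "mat_inverse A = Some B"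
proof (cases "mat_inverse A")
  case None
  \<comment> \<open>Over a field a right inverse of a square matrix is two-sided, so
    \<open>A\<close> is a unit and the result \<open>None\<close> is impossible.\<close>
  have "B * A = 1\<^sub>m n"
    by (rule mat_mult_left_right_inverse[OF A B AB])
  then have "A \<in> Units (ring_mat TYPE('a) n ())"
    using A B AB by (auto simp: Units_def ring_mat_simps)
  then show ?thesis
    using mat_inverse(1)[OF A None, of "()"] by blast
next
  case (Some C)
  then have C: "C * A = 1\<^sub>m n" "C \<in> carrier_mat n n"
    using mat_inverse(2)[OF A] by auto
  have "C = C * (A * B)"
    using C AB by simp
  also have "\<dots> = B"
    using assoc_mult_mat[OF C(2) A B] C B by simp
  finally show ?thesis
    using Some by simp
qed

lemma inv_mat_diag_of_vec:
  fixes v :: "'a::field vec"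
  assumes "\<And>i. i < dim_vec v \<Longrightarrow> v $ i \<noteq> 0"
  shows "inv_mat (diag_of_vec v) = mat_diag (dim_vec v) (\<lambda>i. inverse (v $ i))"
proof -
  let ?n = "dim_vec v"
  have "mat_diag ?n (\<lambda>i. v $ i) * mat_diag ?n (\<lambda>i. inverse (v $ i)) = 1\<^sub>m ?n"
    unfolding mat_diag_diag using assms by (intro eq_matI) (auto simp: mat_diag_def)
  then have "mat_inverse (diag_of_vec v) = Some (mat_diag ?n (\<lambda>i. inverse (v $ i)))"
    unfolding diag_of_vec_def by (intro mat_inverse_eqI) auto
  then show ?thesis
    by (simp add: inv_mat_def)
qed

text \<open>As \<open>V * V'\<close> is the identity, a multiple of the identity can be written in
  the same basis and is absorbed into the diagonal factor.\<close>

lemma diagonalised_shift: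
  fixes V V' :: "'a::field mat"
  assumes V: "V \<in> carrier_mat n n" and V': "V' \<in> carrier_mat n n" and VV': "V * V' = 1\<^sub>m n"
  shows "c \<cdot>\<^sub>m (V * mat_diag n f * V') + t \<cdot>\<^sub>m 1\<^sub>m n = V * mat_diag n (\<lambda>i. t + c * f i) * V'"
proof -
  have "mat_diag n (\<lambda>i. t + c * f i) = c \<cdot>\<^sub>m mat_diag n f + t \<cdot>\<^sub>m 1\<^sub>m n"
    by (intro eq_matI) (auto simp: mat_diag_def)
  then have "V * mat_diag n (\<lambda>i. t + c * f i) = V * (c \<cdot>\<^sub>m mat_diag n f) + V * (t \<cdot>\<^sub>m 1\<^sub>m n)"
    using mult_add_distrib_mat[OF V, of "c \<cdot>\<^sub>m mat_diag n f" n "t \<cdot>\<^sub>m 1\<^sub>m n"] by simp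
  also have "V * (c \<cdot>\<^sub>m mat_diag n f) = c \<cdot>\<^sub>m (V * mat_diag n f)"
    by (rule mult_smult_distrib[OF V mat_diag_dim])
  also have "V * (t \<cdot>\<^sub>m 1\<^sub>m n) = t \<cdot>\<^sub>m V"
    using mult_smult_distrib[OF V, of "1\<^sub>m n" n t] V by simp
  finally have "V * mat_diag n (\<lambda>i. t + c * f i) * V'
      = (c \<cdot>\<^sub>m (V * mat_diag n f)) * V' + (t \<cdot>\<^sub>m V) * V'"
    using add_mult_distrib_mat[of "c \<cdot>\<^sub>m (V * mat_diag n f)" n n "t \<cdot>\<^sub>m V" V' n] V V'
    by (metis mat_diag_dim mult_carrier_mat smult_carrier_mat)
  also have "(c \<cdot>\<^sub>m (V * mat_diag n f)) * V' = c \<cdot>\<^sub>m (V * mat_diag n f * V')"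
    by (rule mult_smult_assoc_mat[OF mult_carrier_mat[OF V mat_diag_dim] V'])
  also have "(t \<cdot>\<^sub>m V) * V' = t \<cdot>\<^sub>m 1\<^sub>m n"
    using mult_smult_assoc_mat[OF V V'] VV' by simp
  finally show ?thesis ..
qed

lemma diagonalised_inverse:
  fixes V V' :: "'a::field mat"
  assumes V: "V \<in> carrier_mat n n" and V': "V' \<in> carrier_mat n n" and VV': "V * V' = 1\<^sub>m n"
    and f: "\<And>i. i < n \<Longrightarrow> f i \<noteq> 0"
  shows "(V * mat_diag n f * V') * (V * mat_diag n (\<lambda>i. inverse (f i)) * V') = 1\<^sub>m n"
proof -
  let ?F = "mat_diag n f" and ?G = "mat_diag n (\<lambda>i. inverse (f i))"
  have FG: "?F * ?G = 1\<^sub>m n"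
    unfolding mat_diag_diag using f by (intro eq_matI) (auto simp: mat_diag_def)
  have V'V: "V' * V = 1\<^sub>m n"
    by (rule mat_mult_left_right_inverse[OF V V' VV'])
  have F: "?F \<in> carrier_mat n n" and G: "?G \<in> carrier_mat n n"
    by simp_all
  have "(V * ?F * V') * (V * ?G * V') = V * (?F * ((V' * V) * (?G * V')))"
    using V V' F G by (simp add: assoc_mult_mat[of _ n n _ n _ n] mult_carrier_mat[of _ n n _ n])
  also have "\<dots> = V * ((?F * ?G) * V')"
    unfolding V'V using V V' F G
    by (simp add: left_mult_one_mat[of _ n n] assoc_mult_mat[of _ n n _ n _ n] mult_carrier_mat[of _ n n _ n] del: mat_diag_diag)
  also have "\<dots> = 1\<^sub>m n"
    unfolding FG using V' VV' by simp
  finally show ?thesis .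
qed

lemma mat_diag_cong: "(\<And>i. i < n \<Longrightarrow> f i = g i) \<Longrightarrow> mat_diag n f = mat_diag n g"
  by (intro eq_matI) (auto simp: mat_diag_def)

lemma inv_mat_shifted_diag:
  assumes "dim_vec v = n" "\<And>i. i < n \<Longrightarrow> v $ i = f i" "\<And>i. i < n \<Longrightarrow> c + f i \<noteq> (0 :: 'a::field)"
  shows "inv_mat (diag_of_vec (shift_vec c v)) = mat_diag n (\<lambda>i. inverse (c + f i))"
  using assms
  by (subst inv_mat_diag_of_vec) (auto simp: shift_vec_def intro!: mat_diag_cong)

subsection \<open>Block inversion by the Schur complement\<close>

text \<open>Multiplying from the right by the three factors in turn clears the upper right block,
  makes both diagonal blocks identities, and clears the lower left block. Writing the lower right
  block as \<open>S + transpose_mat Y * Xi * Y\<close> makes \<open>S\<close> the Schur complement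
  of \<open>X\<close>.\<close>

lemma block_product_inverse:
  fixes X Y S :: "'a::field mat"
  assumes X: "X \<in> carrier_mat p p" and Xi: "Xi \<in> carrier_mat p p" and XXi: "X * Xi = 1\<^sub>m p"
    and Y: "Y \<in> carrier_mat p q"
    and S: "S \<in> carrier_mat q q" and Si: "Si \<in> carrier_mat q q" and SSi: "S * Si = 1\<^sub>m q"
  shows "four_block_mat X Y (transpose_mat Y) (S + transpose_mat Y * Xi * Y) * block_product Xi Y Si
    = 1\<^sub>m (p + q)"
proof -
  let ?T = "transpose_mat Y"
  let ?M = "four_block_mat X Y ?T (S + ?T * Xi * Y)"
  let ?L = "four_block_mat (1\<^sub>m p) (- (Xi * Y)) (0\<^sub>m q p) (1\<^sub>m q)"
  let ?C = "four_block_mat Xi (0\<^sub>m p q) (0\<^sub>m q p) Si"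
  let ?R = "four_block_mat (1\<^sub>m p) (0\<^sub>m p q) (- (?T * Xi)) (1\<^sub>m q)"
  have T: "?T \<in> carrier_mat q p"
    using Y by simp
  have XiY: "Xi * Y \<in> carrier_mat p q" and TXi: "?T * Xi \<in> carrier_mat q p"
    and TXiY: "?T * Xi * Y \<in> carrier_mat q q"
    using T Xi Y by auto
  have M: "?M \<in> carrier_mat (p + q) (p + q)" and L: "?L \<in> carrier_mat (p + q) (p + q)"
    and C: "?C \<in> carrier_mat (p + q) (p + q)" and R: "?R \<in> carrier_mat (p + q) (p + q)"
    using X S Xi Si TXiY by (auto intro!: four_block_carrier_mat add_carrier_mat)
  have "X * (Xi * Y) = Y"
    using assoc_mult_mat[OF X Xi Y] XXi Y by simp
  \<comment> \<open>\<open>12\<close> and \<open>22\<close> are the right-hand blocks of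
    \<open>?M * ?L\<close>. The first vanishes since \<open>Xi\<close> inverts \<open>X\<close>; the
    second leaves only \<open>S\<close>.\<close>
  then have 12: "X * - (Xi * Y) + Y * 1\<^sub>m q = 0\<^sub>m p q"
    using X Xi XiY Y by simp
  have "?T * (Xi * Y) = ?T * Xi * Y"
    using assoc_mult_mat[OF T Xi Y] by simp
  then have "?T * - (Xi * Y) + (S + ?T * Xi * Y) * 1\<^sub>m q = - (?T * Xi * Y) + (S + ?T * Xi * Y)"
    using T Xi Y XiY TXiY S by simp
  also have "\<dots> = S"
    using TXiY S by (intro eq_matI) auto
  finally have 22: "?T * - (Xi * Y) + (S + ?T * Xi * Y) * 1\<^sub>m q = S" .
  have "?M * ?L = four_block_mat X (0\<^sub>m p q) ?T S"
    using mult_four_block_mat[OF X Y T add_carrier_mat[OF TXiY] one_carrier_mat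
        uminus_carrier_mat[OF XiY] zero_carrier_mat one_carrier_mat, of S]
    unfolding 12 22 by (simp only: right_mult_one_mat[OF X] right_mult_one_mat[OF T]
      right_mult_zero_mat[OF Y] right_mult_zero_mat[OF add_carrier_mat[OF TXiY]]
      right_add_zero_mat[OF X] right_add_zero_mat[OF T])
  then have "?M * ?L * ?C = four_block_mat (1\<^sub>m p) (0\<^sub>m p q) (?T * Xi) (1\<^sub>m q)"
    using mult_four_block_mat[OF X zero_carrier_mat T S Xi zero_carrier_mat zero_carrier_mat Si]
      XXi SSi X T S Si TXi by simp
  also have "\<dots> * ?R = 1\<^sub>m (p + q)"
  proof -
    have "1\<^sub>m p + - 0\<^sub>m p p = (1\<^sub>m p :: 'a mat)"
      by (intro eq_matI) auto
    then show ?thesis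
    using mult_four_block_mat[OF one_carrier_mat zero_carrier_mat TXi one_carrier_mat
        one_carrier_mat zero_carrier_mat uminus_carrier_mat[OF TXi] one_carrier_mat] T Xi TXi
      by (simp add: add_uminus_minus_mat[OF TXi TXi] minus_r_inv_mat[OF TXi])
  qed
  also have "?M * ?L * ?C * ?R = ?M * (?L * ?C * ?R)"
    using assoc_mult_mat[OF M L C] assoc_mult_mat[OF M mult_carrier_mat[OF L C] R] by simp
  also have "?L * ?C * ?R = block_product Xi Y Si"
    using Y by (simp add: block_product_def Let_def)
  finally show ?thesis .
qed

lemma beside_mat_gram:
  fixes A B :: "'a::comm_semiring_0 mat"
  assumes "A \<in> carrier_mat r p" "B \<in> carrier_mat r q"
  shows "transpose_mat (beside_mat A B) * beside_mat A B
    = four_block_mat (transpose_mat A * A) (transpose_mat A * B)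
        (transpose_mat B * A) (transpose_mat B * B)"
  using assms by (intro eq_matI) (auto simp: beside_mat_def scalar_prod_def)

text \<open>By the push-through identity both sides agree after multiplication by
  \<open>I + \<tau>\<lambda>D\<^sup>TD\<close>, whose inverse is \<open>G\<close>.\<close>

lemma push_through:
  fixes D G H :: "'a::field mat"
  assumes D: "D \<in> carrier_mat m n" and G: "G \<in> carrier_mat n n" and H: "H \<in> carrier_mat m m"
    and tau: "tau \<noteq> 0"
    and DH: "(lam \<cdot>\<^sub>m (D * transpose_mat D) + (1 / tau) \<cdot>\<^sub>m 1\<^sub>m m) * H = 1\<^sub>m m"
    and DG: "((tau * lam) \<cdot>\<^sub>m (transpose_mat D * D) + 1 \<cdot>\<^sub>m 1\<^sub>m n) * G = 1\<^sub>m n"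
  shows "G + lam \<cdot>\<^sub>m (transpose_mat D * H * D) = 1\<^sub>m n"
proof -
  let ?T = "transpose_mat D"
  let ?Kx = "lam \<cdot>\<^sub>m (D * ?T) + (1 / tau) \<cdot>\<^sub>m 1\<^sub>m m"
  let ?K = "(tau * lam) \<cdot>\<^sub>m (?T * D) + 1 \<cdot>\<^sub>m 1\<^sub>m n"
  have T: "?T \<in> carrier_mat n m"
    using D by simp
  have Kx: "?Kx \<in> carrier_mat m m" and K: "?K \<in> carrier_mat n n"
    using D T by auto
  have THD: "?T * H * D \<in> carrier_mat n n"
    using D T H by auto
  \<comment> \<open>The push-through identity: both sides expand to \<open>tau * lam\<close> times
    \<open>D^T D D^T\<close>, plus \<open>D^T\<close>.\<close>
  have KT: "?K * ?T = tau \<cdot>\<^sub>m (?T * ?Kx)"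
  proof -
    have "?K * ?T = (tau * lam) \<cdot>\<^sub>m (?T * D) * ?T + 1 \<cdot>\<^sub>m 1\<^sub>m n * ?T"
      by (rule add_mult_distrib_mat[where nr = n and n = n and nc = m]) (use D T in auto)
    also have "\<dots> = (tau * lam) \<cdot>\<^sub>m (?T * D * ?T) + ?T"
      using D T by (auto simp: mult_smult_assoc_mat[of _ n n _ m])
    finally have 1: "?K * ?T = (tau * lam) \<cdot>\<^sub>m (?T * D * ?T) + ?T" .
    have "?T * ?Kx = ?T * (lam \<cdot>\<^sub>m (D * ?T)) + ?T * ((1 / tau) \<cdot>\<^sub>m 1\<^sub>m m)"
      by (rule mult_add_distrib_mat[where nr = n and n = m and nc = m]) (use D T in auto)
    also have "\<dots> = lam \<cdot>\<^sub>m (?T * (D * ?T)) + (1 / tau) \<cdot>\<^sub>m ?T"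
      using D T by (auto simp: mult_smult_distrib[of _ n m _ m])
    also have "?T * (D * ?T) = ?T * D * ?T"
      using assoc_mult_mat[OF T D T] by simp
    finally have 2: "?T * ?Kx = lam \<cdot>\<^sub>m (?T * D * ?T) + (1 / tau) \<cdot>\<^sub>m ?T" .
    show ?thesis
      unfolding 1 2 using tau D by (intro eq_matI) (auto simp: algebra_simps)
  qed
  \<comment> \<open>Moving \<open>?K\<close> past \<open>?T\<close> turns it into
    \<open>?Kx\<close>, which \<open>H\<close> cancels.\<close>
  have "?K * (?T * H * D) = tau \<cdot>\<^sub>m (?T * D)"
  proof -
    have "?K * (?T * H * D) = (?K * ?T) * H * D"
      using assoc_mult_mat[OF K mult_carrier_mat[OF T H] D] assoc_mult_mat[OF K T H] by simp
    also have "(?K * ?T) * H = tau \<cdot>\<^sub>m (?T * ?Kx * H)"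
      unfolding KT by (rule mult_smult_assoc_mat[OF mult_carrier_mat[OF T Kx] H])
    also have "?T * ?Kx * H = ?T"
      using assoc_mult_mat[OF T Kx H] DH T by simp
    finally show ?thesis
      using mult_smult_assoc_mat[OF T D] by simp
  qed
  then have "?K * (lam \<cdot>\<^sub>m (?T * H * D)) = (tau * lam) \<cdot>\<^sub>m (?T * D)"
    using mult_smult_distrib[OF K THD, of lam] by (auto simp: ac_simps intro!: eq_matI)
  then have "?K * (G + lam \<cdot>\<^sub>m (?T * H * D)) = 1\<^sub>m n + (tau * lam) \<cdot>\<^sub>m (?T * D)"
    using mult_add_distrib_mat[OF K G smult_carrier_mat[OF THD]] DG by simp
  also have "\<dots> = ?K"
    using D by (intro eq_matI) auto
  finally have *: "?K * (G + lam \<cdot>\<^sub>m (?T * H * D)) = ?K" .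
  have GK: "G * ?K = 1\<^sub>m n"
    by (rule mat_mult_left_right_inverse[OF K G DG])
  have c: "G + lam \<cdot>\<^sub>m (?T * H * D) \<in> carrier_mat n n"
    using G THD by auto
  have "G * (?K * (G + lam \<cdot>\<^sub>m (?T * H * D))) = G + lam \<cdot>\<^sub>m (?T * H * D)"
    using assoc_mult_mat[OF G K c] unfolding GK left_mult_one_mat[OF c] by simp
  then show ?thesis
    unfolding * GK left_mult_one_mat[OF c] by simp
qed

text \<open>The common core of both boundary conditions, over an arbitrary field so that it serves
  the real sine and cosine bases as well as the complex Fourier basis.
  \<open>D * transpose_mat D\<close> and \<open>transpose_mat D * D\<close> get separate bases
  because they differ in size in the mirror case. Nonvanishing hypotheses take the place of
  positivity, which has no meaning in a general field.\<close>

lemma mat_inverse_block_product: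
  fixes D E U U' V V' W W' :: "'a::field mat" and lam tau :: 'a and delta nu mu :: "nat \<Rightarrow> 'a"
  assumes E: "E \<in> carrier_mat q a" and D: "D \<in> carrier_mat m n" and tau: "tau \<noteq> 0"
    and U: "U \<in> carrier_mat q q" "U' \<in> carrier_mat q q" "U * U' = 1\<^sub>m q"
    and V: "V \<in> carrier_mat m m" "V' \<in> carrier_mat m m" "V * V' = 1\<^sub>m m"
    and W: "W \<in> carrier_mat n n" "W' \<in> carrier_mat n n" "W * W' = 1\<^sub>m n"
    and EE: "E * transpose_mat E = U * mat_diag q delta * U'"
    and DD: "D * transpose_mat D = V * mat_diag m nu * V'"
    and DD': "transpose_mat D * D = W * mat_diag n mu * W'"
    and nu: "\<And>i. i < m \<Longrightarrow> 1 / tau + lam * nu i \<noteq> 0"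
    and mu: "\<And>i. i < n \<Longrightarrow> 1 + tau * lam * mu i \<noteq> 0"
    and delta: "\<And>i j. i < q \<Longrightarrow> j < n \<Longrightarrow>
      1 / tau + lam * (delta i * inverse (1 + tau * lam * mu j)) \<noteq> 0"
    and A_def: "A = beside_mat (1\<^sub>m a \<otimes>\<^sub>m transpose_mat D) (transpose_mat E \<otimes>\<^sub>m 1\<^sub>m n)"
  shows "mat_inverse (lam \<cdot>\<^sub>m (transpose_mat A * A) + (1 / tau) \<cdot>\<^sub>m 1\<^sub>m (dim_col A))
    = Some (block_product
        (1\<^sub>m a \<otimes>\<^sub>m (V * mat_diag m (\<lambda>i. inverse (1 / tau + lam * nu i)) * V'))
        (lam \<cdot>\<^sub>m (transpose_mat E \<otimes>\<^sub>m D))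
        ((U \<otimes>\<^sub>m W) * mat_diag (q * n) (\<lambda>i. inverse (1 / tau
             + lam * (delta (i div n) * inverse (1 + tau * lam * mu (i mod n))))) * (U' \<otimes>\<^sub>m W')))"
proof -
  let ?H = "V * mat_diag m (\<lambda>i. inverse (1 / tau + lam * nu i)) * V'"
  let ?K = "lam \<cdot>\<^sub>m (D * transpose_mat D) + (1 / tau) \<cdot>\<^sub>m 1\<^sub>m m"
  let ?G = "W * mat_diag n (\<lambda>i. inverse (1 + tau * lam * mu i)) * W'"
  let ?EE = "E * transpose_mat E"
  let ?p = "a * m" and ?q = "q * n"
  define Xi where "Xi = 1\<^sub>m a \<otimes>\<^sub>m ?H"
  define X where "X = 1\<^sub>m a \<otimes>\<^sub>m ?K"
  define Y where "Y = lam \<cdot>\<^sub>m (transpose_mat E \<otimes>\<^sub>m D)"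
  define S where "S = lam \<cdot>\<^sub>m (?EE \<otimes>\<^sub>m ?G) + (1 / tau) \<cdot>\<^sub>m 1\<^sub>m ?q"
  define Si where "Si = (U \<otimes>\<^sub>m W) * mat_diag ?q (\<lambda>i. inverse (1 / tau
      + lam * (delta (i div n) * inverse (1 + tau * lam * mu (i mod n))))) * (U' \<otimes>\<^sub>m W')"
  have H: "?H \<in> carrier_mat m m" and G: "?G \<in> carrier_mat n n" and K: "?K \<in> carrier_mat m m"
    using V W D by auto
  have EEc: "?EE \<in> carrier_mat q q" and DHD: "transpose_mat D * ?H * D \<in> carrier_mat n n"
    using E D H by auto
  have Xi: "Xi \<in> carrier_mat ?p ?p" and X: "X \<in> carrier_mat ?p ?p" and Y: "Y \<in> carrier_mat ?p ?q"
    unfolding Xi_def X_def Y_def using H K E D by auto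
  have UW: "U \<otimes>\<^sub>m W \<in> carrier_mat ?q ?q" "U' \<otimes>\<^sub>m W' \<in> carrier_mat ?q ?q"
    using U W by auto
  have S: "S \<in> carrier_mat ?q ?q" and Si: "Si \<in> carrier_mat ?q ?q"
    unfolding S_def Si_def using EEc G mult_carrier_mat[OF mult_carrier_mat[OF UW(1) mat_diag_dim] UW(2)]
    by auto
  have KH: "?K * ?H = 1\<^sub>m m"
    unfolding DD diagonalised_shift[OF V] by (rule diagonalised_inverse[OF V nu])
  have XXi: "X * Xi = 1\<^sub>m ?p"
    unfolding X_def Xi_def using K H KH by (subst kron_mat_mult) (auto simp: kron_mat_one)
  \<comment> \<open>The Kronecker product of two diagonalisations is a diagonalisation in the
    Kronecker basis, with the products of the eigenvalues.\<close>
  have "?EE \<otimes>\<^sub>m ?G = (U \<otimes>\<^sub>m W) * mat_diag ?q (\<lambda>i. delta (i div n) * inverse (1 + tau * lam * mu (i mod n)))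
      * (U' \<otimes>\<^sub>m W')"
    unfolding EE kron_mat_diag[of q delta n "\<lambda>i. inverse (1 + tau * lam * mu i)", symmetric]
    using U W by (simp add: kron_mat_mult)
  moreover have UWUW: "(U \<otimes>\<^sub>m W) * (U' \<otimes>\<^sub>m W') = 1\<^sub>m ?q"
    using U W by (simp add: kron_mat_mult kron_mat_one)
  ultimately have "S = (U \<otimes>\<^sub>m W) * mat_diag ?q (\<lambda>i. 1 / tau
      + lam * (delta (i div n) * inverse (1 + tau * lam * mu (i mod n)))) * (U' \<otimes>\<^sub>m W')"
    unfolding S_def using diagonalised_shift[OF UW] by simp
  then have SSi: "S * Si = 1\<^sub>m ?q"
    unfolding Si_def
    by (simp only:) (rule diagonalised_inverse[OF UW UWUW],
      use delta in \<open>auto simp: div_mult_less mod_mult_less\<close>)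
  have "((tau * lam) \<cdot>\<^sub>m (transpose_mat D * D) + 1 \<cdot>\<^sub>m 1\<^sub>m n) * ?G = 1\<^sub>m n"
    unfolding DD' diagonalised_shift[OF W] by (rule diagonalised_inverse[OF W mu])
  from push_through[OF D G H tau KH this]
  have GH: "?G + lam \<cdot>\<^sub>m (transpose_mat D * ?H * D) = 1\<^sub>m n" .
  have YT: "transpose_mat Y = lam \<cdot>\<^sub>m (E \<otimes>\<^sub>m transpose_mat D)"
    unfolding Y_def by (intro eq_matI) (auto simp: index_kron_mat div_mult_less mod_mult_less)
  have EH: "E \<otimes>\<^sub>m (transpose_mat D * ?H) \<in> carrier_mat ?q ?p"
    using E D H by (intro kron_mat_carrier mult_carrier_mat[of "transpose_mat D" n m ?H]) auto
  \<comment> \<open>The mixed-product rule separates the \<open>E\<close> part from the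
    \<open>D\<close> part; the two factors \<open>lam\<close> come from the two copies of
    \<open>Y\<close>.\<close>
  have "transpose_mat Y * Xi * Y = lam \<cdot>\<^sub>m (lam \<cdot>\<^sub>m (?EE \<otimes>\<^sub>m (transpose_mat D * ?H * D)))"
  proof -
    have "transpose_mat Y * Xi = lam \<cdot>\<^sub>m ((E \<otimes>\<^sub>m transpose_mat D) * Xi)"
      unfolding YT by (rule mult_smult_assoc_mat[where n = ?p]) (use E D Xi in auto)
    also have "(E \<otimes>\<^sub>m transpose_mat D) * Xi = E \<otimes>\<^sub>m (transpose_mat D * ?H)"
      unfolding Xi_def using E D V by (simp add: kron_mat_mult)
    also have "(lam \<cdot>\<^sub>m (E \<otimes>\<^sub>m (transpose_mat D * ?H))) * Y
        = lam \<cdot>\<^sub>m ((E \<otimes>\<^sub>m (transpose_mat D * ?H)) * Y)"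
      by (rule mult_smult_assoc_mat[OF EH Y])
    also have "(E \<otimes>\<^sub>m (transpose_mat D * ?H)) * Y
        = lam \<cdot>\<^sub>m ((E \<otimes>\<^sub>m (transpose_mat D * ?H)) * (transpose_mat E \<otimes>\<^sub>m D))"
      unfolding Y_def by (rule mult_smult_distrib[OF EH]) (use E D in auto)
    also have "(E \<otimes>\<^sub>m (transpose_mat D * ?H)) * (transpose_mat E \<otimes>\<^sub>m D)
        = ?EE \<otimes>\<^sub>m (transpose_mat D * ?H * D)"
      using E D V by (simp add: kron_mat_mult)
    finally show ?thesis .
  qed
  also have "lam \<cdot>\<^sub>m (?EE \<otimes>\<^sub>m (transpose_mat D * ?H * D))
      = ?EE \<otimes>\<^sub>m (lam \<cdot>\<^sub>m (transpose_mat D * ?H * D))"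
    by (simp add: kron_mat_smult_right)
  finally have YXY: "transpose_mat Y * Xi * Y = lam \<cdot>\<^sub>m \<dots>" .
  \<comment> \<open>By \<open>GH\<close> the identity splits into \<open>?G\<close> and a second
    summand. The first contributes to \<open>S\<close>, the second gives exactly
    \<open>transpose_mat Y * Xi * Y\<close>, so \<open>S\<close> is the Schur complement.\<close>
  have "?EE \<otimes>\<^sub>m 1\<^sub>m n = ?EE \<otimes>\<^sub>m ?G + ?EE \<otimes>\<^sub>m (lam \<cdot>\<^sub>m (transpose_mat D * ?H * D))"
    unfolding GH[symmetric] by (rule kron_mat_add_right[OF G smult_carrier_mat[OF DHD]])
  then have Z: "lam \<cdot>\<^sub>m (?EE \<otimes>\<^sub>m 1\<^sub>m n) + (1 / tau) \<cdot>\<^sub>m 1\<^sub>m ?q = S + transpose_mat Y * Xi * Y"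
    unfolding YXY S_def using E D W by (intro eq_matI) (auto simp: algebra_simps)
  have dA: "dim_col A = ?p + ?q"
    using D E by (simp add: A_def beside_mat_def)
  have "transpose_mat A * A = four_block_mat (1\<^sub>m a \<otimes>\<^sub>m (D * transpose_mat D)) (transpose_mat E \<otimes>\<^sub>m D)
      (E \<otimes>\<^sub>m transpose_mat D) (?EE \<otimes>\<^sub>m 1\<^sub>m n)"
    unfolding A_def using D E
    by (subst beside_mat_gram[where r = "a * n" and p = ?p and q = ?q])
       (auto simp: transpose_kron_mat kron_mat_mult)
  then have "lam \<cdot>\<^sub>m (transpose_mat A * A) + (1 / tau) \<cdot>\<^sub>m 1\<^sub>m (dim_col A)
      = four_block_mat (lam \<cdot>\<^sub>m (1\<^sub>m a \<otimes>\<^sub>m (D * transpose_mat D)) + (1 / tau) \<cdot>\<^sub>m 1\<^sub>m ?p) Y (transpose_mat Y)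
         (lam \<cdot>\<^sub>m (?EE \<otimes>\<^sub>m 1\<^sub>m n) + (1 / tau) \<cdot>\<^sub>m 1\<^sub>m ?q)"
    unfolding dA YT unfolding Y_def using D E by (intro eq_matI) auto
  also have "lam \<cdot>\<^sub>m (1\<^sub>m a \<otimes>\<^sub>m (D * transpose_mat D)) + (1 / tau) \<cdot>\<^sub>m 1\<^sub>m ?p = X"
    unfolding X_def using D
    by (subst kron_mat_add_right[where r = m and s = m])
       (auto simp: kron_mat_smult_right kron_mat_one)
  finally have M: "lam \<cdot>\<^sub>m (transpose_mat A * A) + (1 / tau) \<cdot>\<^sub>m 1\<^sub>m (dim_col A)
      = four_block_mat X Y (transpose_mat Y) (S + transpose_mat Y * Xi * Y)"
    unfolding Z .
  have B: "block_product Xi Y Si \<in> carrier_mat (?p + ?q) (?p + ?q)"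
    using Xi Y Si by (auto simp: block_product_def Let_def)
  have "mat_inverse (four_block_mat X Y (transpose_mat Y) (S + transpose_mat Y * Xi * Y))
      = Some (block_product Xi Y Si)"
    by (rule mat_inverse_eqI[OF _ B block_product_inverse[OF X Xi XXi Y S Si SSi]])
       (use X S Xi Y in auto)
  then show ?thesis
    unfolding M unfolding Xi_def Y_def Si_def .
qed

subsection \<open>Sine and cosine matrices\<close>

lemma sum_cos_odd: "2 * sin y * (\<Sum>k<n. cos (real (2 * k + 1) * y)) = sin (real (2 * n) * y)"
proof (induction n)
  case (Suc n)
  \<comment> \<open>With the factor \<open>2 * sin y\<close> the sum telescopes; keeping the factor
    avoids a division where \<open>sin y\<close> vanishes.\<close>
  have "2 * sin y * cos (real (2 * n + 1) * y) = sin (real (2 * Suc n) * y) - sin (real (2 * n) * y)"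
    using sin_add[of "real (2 * n + 1) * y" y] sin_diff[of "real (2 * n + 1) * y" y]
    by (simp add: algebra_simps)
  then show ?case
    using Suc by (simp add: distrib_left)
qed simp

text \<open>Again a telescoping sum, now of the differences
  \<open>sin ((2 * k + 1) * y) - sin ((2 * k - 1) * y)\<close>; the lower end
  \<open>sin (- y)\<close> gives the final \<open>sin y\<close>.\<close>

lemma sum_cos_even:
  "2 * sin y * (\<Sum>k<n. cos (real (2 * k) * y)) = sin (real (2 * n) * y - y) + sin y"
proof (induction n)
  case (Suc n)
  have "2 * sin y * cos (real (2 * n) * y)
      = sin (real (2 * Suc n) * y - y) - sin (real (2 * n) * y - y)"
    using sin_diff_sin[of "real (2 * Suc n) * y - y" "real (2 * n) * y - y"]
    by (simp add: field_simps)
  then show ?case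
    using Suc by (simp add: distrib_left)
qed simp

text \<open>The argument lies strictly between \<open>- pi\<close> and \<open>pi\<close>, where the
  sine vanishes only at zero. This allows cancelling the factor \<open>2 * sin y\<close> in the sums
  above.\<close>

lemma sin_frac_pi_nonzero:
  fixes m :: int
  assumes "m \<noteq> 0" "\<bar>m\<bar> < 2 * int n"
  shows "sin (of_int m * pi / (2 * real n)) \<noteq> 0"
proof
  assume *: "sin (of_int m * pi / (2 * real n)) = 0"
  have n: "real n > 0"
    using assms by (cases n) auto
  have m: "real_of_int m < 2 * real n" "- (2 * real n) < real_of_int m"
    using assms by linarith+
  have "real_of_int m * pi < 2 * real n * pi" "- (2 * real n) * pi < real_of_int m * pi"
    using mult_strict_right_mono[OF m(1) pi_gt_zero] mult_strict_right_mono[OF m(2) pi_gt_zero] by auto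
  then have "of_int m * pi / (2 * real n) < pi" "- pi < of_int m * pi / (2 * real n)"
    using n by (auto simp: field_simps)
  then have "of_int m * pi / (2 * real n) = 0"
    using sin_eq_0_pi * by blast
  then show False
    using assms n by simp
qed

lemma sum_cos_odd_pi:
  fixes m :: int
  assumes "n > 0" "\<bar>m\<bar> < 2 * int n"
  shows "(\<Sum>k<n. cos (real (2 * k + 1) * (of_int m * pi / (2 * real n)))) = (if m = 0 then real n else 0)"
proof (cases "m = 0")
  case False
  have "real (2 * n) * (of_int m * pi / (2 * real n)) = of_int m * pi"
    using assms by simp
  then have "sin (real (2 * n) * (of_int m * pi / (2 * real n))) = 0"
    by (simp only: sin_npi_int mult.commute[of _ pi])
  then show ?thesis
    using sum_cos_odd[of "of_int m * pi / (2 * real n)" n] sin_frac_pi_nonzero[OF False assms(2)] False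
    by simp
qed simp

text \<open>For \<open>m \<noteq> 0\<close> the closed form is
  \<open>sin (m * pi - y) + sin y\<close>, hence \<open>0\<close> or \<open>2 * sin y\<close>
  depending on parity. The nonzero value for odd \<open>m\<close> does no harm later, since two sums
  with frequencies of equal parity are subtracted.\<close>

lemma sum_cos_even_pi:
  fixes m :: int
  assumes "n > 0" "\<bar>m\<bar> < 2 * int n"
  shows "(\<Sum>k<n. cos (real (2 * k) * (of_int m * pi / (2 * real n))))
    = (if m = 0 then real n else if even m then 0 else 1)"
proof (cases "m = 0")
  case False
  let ?y = "of_int m * pi / (2 * real n)"
  have "real (2 * n) * ?y - ?y = pi * of_int m - ?y"
    using assms by simp
  then have "sin (real (2 * n) * ?y - ?y) = - cos (pi * of_int m) * sin ?y"
    by (simp only: sin_diff sin_npi_int)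
  moreover have a: "t = (if e then 0 else 2) * s"
    if "t = b + s" "b = - c * s" "c = (if e then 1 else - 1)" for b c s t :: real and e
    using that by auto
  moreover have "cos (pi * of_int m) = (if even m then 1 else - 1)"
    by (simp add: cos_npi_int)
  ultimately have "2 * sin ?y * (\<Sum>k<n. cos (real (2 * k) * ?y)) = (if even m then 0 else 2) * sin ?y"
    using a[OF sum_cos_even] by blast
  moreover have "t = c / 2" if "2 * s * t = c * s" "s \<noteq> 0" for s t c :: real
    using that by simp
  ultimately have "(\<Sum>k<n. cos (real (2 * k) * ?y)) = (if even m then 0 else 2) / 2"
    using sin_frac_pi_nonzero[OF False assms(2)] by blast
  then show ?thesis
    using False by (simp only: split: if_split) simp
qed simp

section \<open>Carriers; orthogonality of the sine and cosine matrices\<close>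

lemma sine_mat_carrier [simp]: "sine_mat n \<in> carrier_mat (n - 1) (n - 1)"
  by (simp add: sine_mat_def)

lemma cosine_mat_carrier [simp]: "cosine_mat n \<in> carrier_mat n n"
  by (simp add: cosine_mat_def)

lemma fourier_mat_carrier [simp]: "fourier_mat n \<in> carrier_mat n n"
  by (simp add: fourier_mat_def)

lemma diff_mat_carrier [simp]: "diff_mat n \<in> carrier_mat (n - 1) n"
  by (simp add: diff_mat_def)

lemma diff_per_mat_carrier [simp]: "diff_per_mat n \<in> carrier_mat n n"
  by (simp add: diff_per_mat_def)

lemmas [simp] =
  sine_mat_carrier[unfolded One_nat_def] diff_mat_carrier[unfolded One_nat_def]

text \<open>A product of two sines is half a difference of cosines with frequencies
  \<open>j - l\<close> and \<open>j + l + 2\<close>. These have the same parity, so the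
  contributions of odd frequencies cancel, and only \<open>j = l\<close> leaves the value
  \<open>n\<close>. The matrix being symmetric, it is its own inverse.\<close>

lemma sine_mat_square:
  assumes "n \<ge> 2"
  shows "sine_mat n * sine_mat n = 1\<^sub>m (n - 1)"
proof (rule eq_matI)
  fix j l
  assume "j < dim_row (1\<^sub>m (n - 1))" "l < dim_col (1\<^sub>m (n - 1))"
  then have jl: "j < n - 1" "l < n - 1"
    by auto
  let ?s = "\<lambda>j k. sin (real (j * k) * pi / real n)"
  let ?c = "\<lambda>m k. cos (real (2 * k) * (of_int m * pi / (2 * real n)))"
  have "(sine_mat n * sine_mat n) $$ (j, l)
      = (\<Sum>k<n - 1. (sqrt (2 / real n) * ?s (j + 1) (k + 1)) * (sqrt (2 / real n) * ?s (k + 1) (l + 1)))"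
    using jl by (simp add: sine_mat_def scalar_prod_def lessThan_atLeast0)
  also have "\<dots> = (\<Sum>k<n - 1. 2 / real n * (?s (j + 1) (Suc k) * ?s (l + 1) (Suc k)))"
  proof (rule sum.cong[OF refl])
    fix k
    have "(sqrt (2 / real n) * ?s (j + 1) (k + 1)) * (sqrt (2 / real n) * ?s (k + 1) (l + 1))
      = (sqrt (2 / real n) * sqrt (2 / real n)) * (?s (j + 1) (Suc k) * ?s (l + 1) (Suc k))"
      by (simp only: mult.commute[of "k + 1" "l + 1"] ac_simps Suc_eq_plus1)
    then show "(sqrt (2 / real n) * ?s (j + 1) (k + 1)) * (sqrt (2 / real n) * ?s (k + 1) (l + 1))
      = 2 / real n * (?s (j + 1) (Suc k) * ?s (l + 1) (Suc k))"
      by simp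
  qed
  \<comment> \<open>The vanishing term \<open>k = 0\<close> is added so that the sum has the full
    range \<open>k < n\<close>.\<close>
  also have "\<dots> = (\<Sum>k<Suc (n - 1). 2 / real n * (?s (j + 1) k * ?s (l + 1) k))"
    by (subst sum.lessThan_Suc_shift) simp
  also have "\<dots> = (\<Sum>k<n. 1 / real n * (?c (int j - int l) k - ?c (int j + int l + 2) k))"
  proof (rule sum.cong)
    fix k
    have a: "real ((j + 1) * k) * pi / real n - real ((l + 1) * k) * pi / real n
        = real (2 * k) * (of_int (int j - int l) * pi / (2 * real n))"
      using assms by (simp add: field_simps)
    have b: "real ((j + 1) * k) * pi / real n + real ((l + 1) * k) * pi / real n
        = real (2 * k) * (of_int (int j + int l + 2) * pi / (2 * real n))"
      using assms by (simp add: field_simps)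
    have "2 / r * (u / 2) = 1 / r * u" for r u :: real
      by simp
    then show "2 / real n * (?s (j + 1) k * ?s (l + 1) k)
        = 1 / real n * (?c (int j - int l) k - ?c (int j + int l + 2) k)"
      unfolding sin_times_sin a b .
  qed (use assms in auto)
  also have "\<dots> = 1 / real n * ((\<Sum>k<n. ?c (int j - int l) k) - (\<Sum>k<n. ?c (int j + int l + 2) k))"
    by (simp only: sum_subtractf sum_distrib_left right_diff_distrib)
  also have "\<dots> = (if j = l then 1 else 0)"
    using assms jl
    by (subst (1 2) sum_cos_even_pi) auto
  finally show "(sine_mat n * sine_mat n) $$ (j, l) = 1\<^sub>m (n - 1) $$ (j, l)"
    using jl by simp
qed (auto simp: sine_mat_def)

text \<open>A product of two cosines gives the frequencies \<open>j - l\<close> and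
  \<open>j + l\<close>, whose sums vanish except at frequency zero. For \<open>j = l = 0\<close>
  both survive, and the factor \<open>1 / sqrt 2\<close> in the first row compensates for the
  doubling.\<close>

lemma cosine_mat_orthogonal:
  assumes "n \<ge> 2"
  shows "cosine_mat n * transpose_mat (cosine_mat n) = 1\<^sub>m n"
proof (rule eq_matI)
  fix j l
  assume "j < dim_row (1\<^sub>m n)" "l < dim_col (1\<^sub>m n)"
  then have jl: "j < n" "l < n"
    by auto
  let ?e = "\<lambda>j::nat. if j = 0 then 1 / sqrt 2 else 1"
  let ?s = "\<lambda>j k. cos (real (j * (2 * k + 1)) * pi / (2 * real n))"
  let ?c = "\<lambda>m k. cos (real (2 * k + 1) * (of_int m * pi / (2 * real n)))"
  have "(cosine_mat n * transpose_mat (cosine_mat n)) $$ (j, l)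
      = (\<Sum>k<n. (sqrt (2 / real n) * (?e j * ?s j k)) * (sqrt (2 / real n) * (?e l * ?s l k)))"
    using jl by (simp add: cosine_mat_def scalar_prod_def lessThan_atLeast0)
  also have "\<dots> = (\<Sum>k<n. ?e j * ?e l / real n * (?c (int j - int l) k + ?c (int j + int l) k))"
  proof (rule sum.cong[OF refl])
    fix k
    have a: "real (j * (2 * k + 1)) * pi / (2 * real n) - real (l * (2 * k + 1)) * pi / (2 * real n)
        = real (2 * k + 1) * (of_int (int j - int l) * pi / (2 * real n))"
      using assms by (simp add: field_simps)
    have b: "real (j * (2 * k + 1)) * pi / (2 * real n) + real (l * (2 * k + 1)) * pi / (2 * real n)
        = real (2 * k + 1) * (of_int (int j + int l) * pi / (2 * real n))"
      using assms by (simp add: field_simps)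
    have "(sqrt (2 / real n) * (?e j * ?s j k)) * (sqrt (2 / real n) * (?e l * ?s l k))
        = (sqrt (2 / real n) * sqrt (2 / real n)) * (?e j * ?e l) * (?s j k * ?s l k)"
      by (simp only: ac_simps)
    also have "\<dots> = 2 / real n * (?e j * ?e l) * (?s j k * ?s l k)"
      by simp
    finally show "(sqrt (2 / real n) * (?e j * ?s j k)) * (sqrt (2 / real n) * (?e l * ?s l k))
        = ?e j * ?e l / real n * (?c (int j - int l) k + ?c (int j + int l) k)"
      unfolding cos_times_cos a b by simp
  qed
  also have "\<dots> = ?e j * ?e l / real n
      * ((\<Sum>k<n. ?c (int j - int l) k) + (\<Sum>k<n. ?c (int j + int l) k))"
    by (simp only: sum.distrib sum_distrib_left distrib_left)
  also have "\<dots> = (if j = l then 1 else 0)"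
    using assms jl
    by (subst (1 2) sum_cos_odd_pi) (auto simp: field_simps)
  finally show "(cosine_mat n * transpose_mat (cosine_mat n)) $$ (j, l) = 1\<^sub>m n $$ (j, l)"
    using jl by simp
qed (auto simp: cosine_mat_def)

section \<open>Diagonalisation of the discrete Laplacians\<close>

lemma eq_diagonalised:
  fixes A V V' :: "'a::comm_ring_1 mat"
  assumes A: "A \<in> carrier_mat n n" and V: "V \<in> carrier_mat n n" and V': "V' \<in> carrier_mat n n"
    and VV': "V * V' = 1\<^sub>m n" and AV: "A * V = V * mat_diag n f"
  shows "A = V * mat_diag n f * V'"
  using assoc_mult_mat[OF A V V'] A unfolding VV' AV by simp

lemma index_diff_mat_mult:
  assumes "M \<in> carrier_mat n c" "j < n - 1" "k < c"
  shows "(diff_mat n * M) $$ (j, k) = real n * (M $$ (j + 1, k) - M $$ (j, k))"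
proof -
  have "(diff_mat n * M) $$ (j, k) = (diff_mat n *\<^sub>v col M k) $ j"
    using assms by (simp add: diff_mat_def)
  also have "\<dots> = real n * (M $$ (j + 1, k) - M $$ (j, k))"
    using assms by (subst diff_mat_mult_vec) auto
  finally show ?thesis .
qed

text \<open>The transpose takes a negative difference of \<open>M\<close> continued by zero to the
  rows before the first and after the last. This continuation encodes the boundary condition at both
  ends.\<close>

lemma index_transpose_diff_mat_mult:
  assumes "M \<in> carrier_mat (n - 1) c" "j < n" "k < c"
  shows "(transpose_mat (diff_mat n) * M) $$ (j, k)
    = real n * ((if j = 0 then 0 else M $$ (j - 1, k)) - (if j = n - 1 then 0 else M $$ (j, k)))"
proof -
  have "(transpose_mat (diff_mat n) * M) $$ (j, k)
      = (\<Sum>i<n - 1. (if j = i + 1 then real n else if j = i then - real n else 0) * M $$ (i, k))"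
    using assms by (simp add: diff_mat_def scalar_prod_def lessThan_atLeast0)
  \<comment> \<open>For \<open>j = 0\<close> the truncated \<open>j - 1\<close> is \<open>0\<close>
    as well, so that case needs its own guard.\<close>
  also have "\<dots> = (\<Sum>i<n - 1. (if i = j - 1 then (if j = 0 then 0 else real n * M $$ (i, k)) else 0)
      + (if i = j then - real n * M $$ (i, k) else 0))"
    by (intro sum.cong) auto
  also have "\<dots> = real n * ((if j = 0 then 0 else M $$ (j - 1, k)) - (if j = n - 1 then 0 else M $$ (j, k)))"
    using assms by (auto simp: sum.distrib sum.delta algebra_simps)
  finally show ?thesis .
qed

text \<open>Sine and, in the next lemma, cosine are eigenfunctions of the second difference with
  step \<open>2 * x\<close>; the eigenvalue is \<open>2 - 2 * cos (2 * x)\<close>, which equals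
  \<open>4 * (sin x)^2\<close>.\<close>

lemma second_difference_sin:
  "2 * sin a - sin (a + 2 * x) - sin (a - 2 * x) = 4 * (sin x)\<^sup>2 * sin (a :: real)"
  unfolding sin_add sin_diff cos_double_sin by (simp add: algebra_simps)

lemma second_difference_cos:
  "2 * cos a - cos (a + 2 * x) - cos (a - 2 * x) = 4 * (sin x)\<^sup>2 * cos (a :: real)"
  unfolding cos_add cos_diff cos_double_sin by (simp add: algebra_simps)

text \<open>Each column samples a sine that vanishes at the grid points \<open>0\<close> and
  \<open>n\<close>. The continuation by zero in \<open>index_transpose_diff_mat_mult\<close> thus
  agrees with the sine itself, and the second difference formula holds in every row.\<close>

lemma sine_mat_diagonalises:
  assumes n: "n \<ge> 2"
  shows "diff_mat n * transpose_mat (diff_mat n)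
    = sine_mat n * mat_diag (n - 1) (\<lambda>k. (real n)\<^sup>2 * (4 * (sin (real (k + 1) * pi / (2 * real n)))\<^sup>2))
      * sine_mat n"
proof (rule eq_diagonalised[OF _ _ _ sine_mat_square[OF n]])
  let ?D = "diff_mat n"
  let ?S = "sine_mat n"
  let ?T = "transpose_mat ?D * ?S"
  have T: "?T \<in> carrier_mat n (n - 1)"
    by (rule mult_carrier_mat[of _ _ "n - 1"]) auto
  let ?d = "\<lambda>k. (real n)\<^sup>2 * (4 * (sin (real (k + 1) * pi / (2 * real n)))\<^sup>2)"
  have "?D * ?T = ?S * mat_diag (n - 1) ?d"
  proof (rule eq_matI)
    fix j k
    assume "j < dim_row (?S * mat_diag (n - 1) ?d)" "k < dim_col (?S * mat_diag (n - 1) ?d)"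
    then have jk: "j < n - 1" "k < n - 1"
      by (auto simp: sine_mat_def)
    \<comment> \<open>\<open>x\<close> is half the step angle: with indices from \<open>0\<close>,
      row \<open>i\<close> samples the sine at \<open>2 * (i + 1) * x\<close>.\<close>
    define x where "x = real (k + 1) * pi / (2 * real n)"
    define s where "s = sqrt (2 / real n)"
    have S: "?S $$ (i, k) = s * sin (2 * real (i + 1) * x)" if "i < n - 1" for i
    proof -
      have "real ((i + 1) * (k + 1)) * pi / real n = 2 * real (i + 1) * x"
        using n by (simp add: x_def field_simps)
      then show ?thesis
        using that jk by (simp add: sine_mat_def s_def)
    qed
    have "2 * real n * x = real (k + 1) * pi"
      using n by (simp add: x_def)
    then have boundary: "sin (2 * real n * x) = 0"
      by (simp only: sin_npi)
    have T': "?T $$ (i, k) = real n * s * (sin (2 * real i * x) - sin (2 * real (i + 1) * x))"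
      if "i < n" for i
    proof -
      have "(if i = 0 then 0 else ?S $$ (i - 1, k)) = s * sin (2 * real i * x)"
        using that S[of "i - 1"] by (cases i) auto
      moreover have "(if i = n - 1 then 0 else ?S $$ (i, k)) = s * sin (2 * real (i + 1) * x)"
      proof (cases "i = n - 1")
        case True
        then have "real (i + 1) = real n"
          using n by simp
        then show ?thesis
          using True boundary by (simp only:) simp
      qed (use that S[of i] in auto)
      ultimately show ?thesis
        unfolding index_transpose_diff_mat_mult[OF sine_mat_carrier that jk(2)]
        by (simp only:) (simp add: algebra_simps)
    qed
    have "(?D * ?T) $$ (j, k) = real n * (?T $$ (j + 1, k) - ?T $$ (j, k))"
      by (rule index_diff_mat_mult[OF T jk])
    also have "\<dots> = (real n)\<^sup>2 * s * (2 * sin (2 * real (j + 1) * x)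
        - sin (2 * real (j + 1) * x + 2 * x) - sin (2 * real (j + 1) * x - 2 * x))"
      using jk by (simp add: T' power2_eq_square algebra_simps)
    also have "\<dots> = (?S * mat_diag (n - 1) ?d) $$ (j, k)"
      unfolding second_difference_sin mat_diag_mult_right[OF sine_mat_carrier]
      using jk by (simp add: S x_def)
    finally show "(?D * ?T) $$ (j, k) = (?S * mat_diag (n - 1) ?d) $$ (j, k)" .
  qed (auto simp: sine_mat_def diff_mat_def)
  then show "?D * transpose_mat ?D * ?S = ?S * mat_diag (n - 1) ?d"
    using assoc_mult_mat[of ?D "n - 1" n "transpose_mat ?D" "n - 1" ?S "n - 1"] by simp
qed (auto intro: mult_carrier_mat[of _ _ n])

text \<open>The cosines are sampled at half-integer grid points, so their differences are sines
  living on the integer points and vanish at both ends. This Neumann condition matches the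
  continuation by zero.\<close>

lemma cosine_mat_diagonalises:
  assumes n: "n \<ge> 2"
  shows "transpose_mat (diff_mat n) * diff_mat n
    = transpose_mat (cosine_mat n)
      * mat_diag n (\<lambda>k. (real n)\<^sup>2 * (4 * (sin (real k * pi / (2 * real n)))\<^sup>2)) * cosine_mat n"
proof (rule eq_diagonalised)
  let ?D = "diff_mat n"
  let ?C = "transpose_mat (cosine_mat n)"
  let ?E = "?D * ?C"
  have E: "?E \<in> carrier_mat (n - 1) n"
    by (rule mult_carrier_mat[of _ _ n]) auto
  have C: "?C \<in> carrier_mat n n"
    by simp
  show "?C * cosine_mat n = 1\<^sub>m n"
    by (rule mat_mult_left_right_inverse[OF cosine_mat_carrier C cosine_mat_orthogonal[OF n]])
  let ?d = "\<lambda>k. (real n)\<^sup>2 * (4 * (sin (real k * pi / (2 * real n)))\<^sup>2)"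
  have "transpose_mat ?D * ?E = ?C * mat_diag n ?d"
  proof (rule eq_matI)
    fix j k
    assume "j < dim_row (?C * mat_diag n ?d)" "k < dim_col (?C * mat_diag n ?d)"
    then have jk: "j < n" "k < n"
      by (auto simp: cosine_mat_def)
    define x where "x = real k * pi / (2 * real n)"
    define c where "c = sqrt (2 / real n) * (if k = 0 then 1 / sqrt 2 else 1)"
    have C': "?C $$ (i, k) = c * cos ((2 * real i + 1) * x)" if "i < n" for i
    proof -
      have "real (k * (2 * i + 1)) * pi / (2 * real n) = (2 * real i + 1) * x"
        using n by (simp add: x_def field_simps)
      then show ?thesis
        using that jk by (simp add: cosine_mat_def c_def)
    qed
    \<comment> \<open>\<open>e y\<close> is the scaled difference of the cosine across the point
      \<open>y\<close>, a multiple of \<open>sin y * sin x\<close>; hence it vanishes at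
      \<open>0\<close> and at \<open>k * pi\<close>.\<close>
    define e where "e y = real n * c * (cos (y + x) - cos (y - x))" for y
    have E': "?E $$ (i, k) = e (2 * real (i + 1) * x)" if "i < n - 1" for i
      using that jk index_diff_mat_mult[OF C that jk(2)]
      by (simp add: C' e_def algebra_simps)
    have "2 * real n * x = real k * pi"
      using n by (simp add: x_def)
    then have boundary: "e (2 * real n * x) = 0" "e 0 = 0"
      by (simp_all only: e_def) (simp_all add: cos_add cos_diff sin_npi)
    have "(transpose_mat ?D * ?E) $$ (j, k) = real n * (e (2 * real j * x) - e (2 * real (j + 1) * x))"
    proof -
      have "(if j = 0 then 0 else ?E $$ (j - 1, k)) = e (2 * real j * x)"
        using jk E'[of "j - 1"] boundary by (cases j) auto
      moreover have "(if j = n - 1 then 0 else ?E $$ (j, k)) = e (2 * real (j + 1) * x)"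
      proof (cases "j = n - 1")
        case True
        then have "real (j + 1) = real n"
          using n by simp
        then show ?thesis
          using True boundary by (simp only:) simp
      qed (use jk E'[of j] in auto)
      ultimately show ?thesis
        unfolding index_transpose_diff_mat_mult[OF E jk] by (simp only:)
    qed
    also have "\<dots> = (real n)\<^sup>2 * c * (2 * cos ((2 * real j + 1) * x)
        - cos ((2 * real j + 1) * x + 2 * x) - cos ((2 * real j + 1) * x - 2 * x))"
      by (simp add: e_def power2_eq_square algebra_simps)
    also have "\<dots> = (?C * mat_diag n ?d) $$ (j, k)"
      unfolding second_difference_cos
      using jk by (simp add: mat_diag_mult_right[OF C] C' x_def del: index_transpose_mat)
    finally show "(transpose_mat ?D * ?E) $$ (j, k) = (?C * mat_diag n ?d) $$ (j, k)" .
  qed (auto simp: cosine_mat_def diff_mat_def)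
  then show "transpose_mat ?D * ?D * ?C = ?C * mat_diag n ?d"
    using assoc_mult_mat[of "transpose_mat ?D" n "n - 1" ?D n ?C n] by simp
qed (auto intro: mult_carrier_mat[of _ _ "n - 1"])

subsection \<open>The Fourier matrix\<close>

text \<open>Column \<open>k\<close> of the Fourier matrix consists, up to scaling, of the powers of
  this root of unity. A cyclic shift of the rows then becomes a multiplication by the root or its
  conjugate.\<close>

definition fourier_root :: "nat \<Rightarrow> nat \<Rightarrow> complex" where
  "fourier_root n k = cis (- (2 * pi * real k / real n))"

lemma index_fourier_mat:
  assumes "j < n" "k < n"
  shows "fourier_mat n $$ (j, k) = complex_of_real (sqrt (1 / real n)) * fourier_root n k ^ j"
proof -
  have "exp (- 2 * complex_of_real pi * \<i> * of_nat (j * k) / of_nat n)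
      = cis (real j * (- (2 * pi * real k / real n)))"
    unfolding cis_conv_exp by (simp add: field_simps)
  then show ?thesis
    using assms unfolding fourier_root_def DeMoivre by (simp add: fourier_mat_def)
qed

lemma fourier_mat_symmetric:
  assumes "j < n" "k < n"
  shows "fourier_mat n $$ (j, k) = fourier_mat n $$ (k, j)"
  using assms by (simp add: fourier_mat_def mult.commute)

lemma fourier_root_power: "n > 0 \<Longrightarrow> fourier_root n k ^ n = 1"
  using cis_multiple_2pi[of "- real k"] by (simp add: fourier_root_def DeMoivre ac_simps)

lemma fourier_root_mult_cnj: "fourier_root n k * cnj (fourier_root n k) = 1"
  by (simp add: fourier_root_def cis_cnj cis_mult)

text \<open>The root has modulus one, so the product is \<open>2\<close> minus twice its real part
  \<open>cos (2 * pi * k / n)\<close>; the double-angle formula gives the sine.\<close>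

lemma fourier_root_eigenvalue:
  "(1 - cnj (fourier_root n k)) * (1 - fourier_root n k)
    = complex_of_real (4 * (sin (real k * pi / real n))\<^sup>2)"
proof -
  let ?x = "real k * pi / real n"
  have x: "2 * pi * real k / real n = 2 * ?x"
    by simp
  have "(1 - cnj (fourier_root n k)) * (1 - fourier_root n k)
      = 2 - (fourier_root n k + cnj (fourier_root n k))"
    using fourier_root_mult_cnj[of n k] by (simp add: algebra_simps)
  also have "fourier_root n k + cnj (fourier_root n k) = complex_of_real (2 * cos (2 * ?x))"
    unfolding fourier_root_def x by (simp add: complex_eq_iff)
  finally show ?thesis
    unfolding cos_double_sin by simp
qed

text \<open>The entry at \<open>j\<close>, \<open>l\<close> is a geometric sum with ratio
  \<open>z\<close>, where \<open>z ^ n = 1\<close>; it vanishes when \<open>z \<noteq> 1\<close>. By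
  symmetry of the Fourier matrix its rows are read as columns, whose entries are powers of a single
  root.\<close>

lemma fourier_mat_unitary:
  assumes n: "n \<ge> 2"
  shows "fourier_mat n * map_mat cnj (fourier_mat n) = 1\<^sub>m n"
proof (rule eq_matI)
  fix j l
  assume "j < dim_row (1\<^sub>m n)" "l < dim_col (1\<^sub>m n)"
  then have jl: "j < n" "l < n"
    by auto
  define z where "z = fourier_root n j * cnj (fourier_root n l)"
  have "(fourier_mat n * map_mat cnj (fourier_mat n)) $$ (j, l)
      = (\<Sum>k<n. fourier_mat n $$ (k, j) * cnj (fourier_mat n $$ (k, l)))"
    using jl carrier_matD[OF fourier_mat_carrier[of n]] fourier_mat_symmetric[of j n]
    by (auto simp: scalar_prod_def lessThan_atLeast0 intro!: sum.cong)
  also have "\<dots> = (\<Sum>k<n. 1 / of_nat n * z ^ k)"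
  proof (rule sum.cong[OF refl])
    fix k
    assume k: "k \<in> {..<n}"
    have "complex_of_real (sqrt (1 / real n)) * complex_of_real (sqrt (1 / real n)) = 1 / of_nat n"
      by (simp only: of_real_mult[symmetric] real_sqrt_mult_self) simp
    then show "fourier_mat n $$ (k, j) * cnj (fourier_mat n $$ (k, l)) = 1 / of_nat n * z ^ k"
      using k jl by (simp add: index_fourier_mat z_def power_mult_distrib ac_simps)
  qed
  also have "\<dots> = (if j = l then 1 else 0)"
  proof (cases "j = l")
    case True
    then show ?thesis
      using n by (simp add: z_def fourier_root_mult_cnj)
  next
    case False
    have "z ^ n = 1"
      using n by (simp add: z_def power_mult_distrib fourier_root_power flip: complex_cnj_power)
    \<comment> \<open>\<open>z = 1\<close> would make \<open>l - j\<close> a multiple of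
      \<open>n\<close>, impossible for distinct indices below \<open>n\<close>.\<close>
    moreover have "z \<noteq> 1"
    proof
      assume "z = 1"
      then have "cis (2 * pi * (real l - real j) / real n) = 1"
        by (simp add: z_def fourier_root_def cis_cnj cis_mult right_diff_distrib diff_divide_distrib)
      then have "cos (2 * pi * (real l - real j) / real n) = 1"
        by (simp add: complex_eq_iff)
      then obtain i :: int where "2 * pi * (real l - real j) / real n = of_int i * 2 * pi"
        using cos_one_2pi_int by blast
      then have "(2 * pi) * (real l - real j) = (2 * pi) * (of_int i * real n)"
        using n by (simp add: field_simps)
      then have "real l - real j = of_int i * real n"
        by (subst (asm) mult_left_cancel) auto
      then have "real_of_int (int l - int j) = real_of_int (i * int n)"
        by simp
      then have "int l - int j = i * int n"
        by (simp only: of_int_eq_iff)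
      moreover have "\<bar>int l - int j\<bar> < int n"
        using jl by linarith
      ultimately have "\<bar>i\<bar> * int n < 1 * int n"
        by (simp add: abs_mult)
      then have "i = 0"
        using n by (simp only: mult_less_cancel_right) auto
      then show False
        using \<open>int l - int j = i * int n\<close> False by simp
    qed
    ultimately show ?thesis
      using False by (simp add: sum_divide_distrib[symmetric] geometric_sum)
  qed
  finally show "(fourier_mat n * map_mat cnj (fourier_mat n)) $$ (j, l) = 1\<^sub>m n $$ (j, l)"
    using jl by simp
qed (auto simp: fourier_mat_def)

text \<open>Passing to the cyclically preceding row multiplies column \<open>k\<close> by the
  conjugate root. The wrap-around at row \<open>0\<close> is consistent because the
  \<open>n\<close>-th power of the root is \<open>1\<close>.\<close>

lemma diff_per_mat_mult_fourier:
  assumes n: "n \<ge> 2"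
  shows "complex_mat (diff_per_mat n) * fourier_mat n
    = fourier_mat n * mat_diag n (\<lambda>k. of_nat n * (1 - cnj (fourier_root n k)))"
proof (rule eq_matI)
  let ?d = "\<lambda>k. of_nat n * (1 - cnj (fourier_root n k))"
  fix j k
  assume "j < dim_row (fourier_mat n * mat_diag n ?d)" "k < dim_col (fourier_mat n * mat_diag n ?d)"
  then have jk: "j < n" "k < n"
    by (auto simp: fourier_mat_def)
  define p where "p = (if j = 0 then n - 1 else j - 1)"
  let ?w = "fourier_root n k"
  let ?s = "complex_of_real (sqrt (1 / real n))"
  have p: "p < n" "p \<noteq> j"
    using jk n by (auto simp: p_def)
  have w: "cnj ?w * ?w ^ Suc i = ?w ^ i" for i
    using fourier_root_mult_cnj[of n k] by (simp add: mult.assoc[symmetric] mult.commute)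
  have pw: "?w ^ p = cnj ?w * ?w ^ j"
  proof (cases j)
    case 0
    have "?w ^ Suc (n - 1) = 1"
      using n by (simp add: fourier_root_power)
    then show ?thesis
      using w[of "n - 1"] 0 by (simp add: p_def)
  next
    case (Suc i)
    then show ?thesis
      using w[of i] by (simp add: p_def)
  qed
  have "(complex_mat (diff_per_mat n) * fourier_mat n) $$ (j, k)
      = (\<Sum>i<n. complex_of_real (if i = j then real n else if i = p then - real n else 0) * fourier_mat n $$ (i, k))"
    using jk carrier_matD[OF fourier_mat_carrier[of n]]
    by (auto simp: diff_per_mat_def scalar_prod_def lessThan_atLeast0 p_def intro!: sum.cong)
  also have "\<dots> = (\<Sum>i<n. (if i = j then of_nat n * fourier_mat n $$ (i, k) else 0)
      + (if i = p then - of_nat n * fourier_mat n $$ (i, k) else 0))"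
    using p by (intro sum.cong) auto
  also have "\<dots> = of_nat n * (fourier_mat n $$ (j, k) - fourier_mat n $$ (p, k))"
    using jk p by (simp add: sum.distrib algebra_simps)
  also have "\<dots> = (fourier_mat n * mat_diag n ?d) $$ (j, k)"
    using jk p by (simp add: mat_diag_mult_right[OF fourier_mat_carrier] index_fourier_mat pw algebra_simps)
  finally show "(complex_mat (diff_per_mat n) * fourier_mat n) $$ (j, k)
      = (fourier_mat n * mat_diag n ?d) $$ (j, k)" .
qed (auto simp: fourier_mat_def diff_per_mat_def)

text \<open>The transpose looks at the cyclic successor instead, which multiplies by the root
  itself.\<close>

lemma transpose_diff_per_mat_mult_fourier:
  assumes n: "n \<ge> 2"
  shows "transpose_mat (complex_mat (diff_per_mat n)) * fourier_mat n
    = fourier_mat n * mat_diag n (\<lambda>k. of_nat n * (1 - fourier_root n k))"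
proof (rule eq_matI)
  let ?d = "\<lambda>k. of_nat n * (1 - fourier_root n k)"
  fix j k
  assume "j < dim_row (fourier_mat n * mat_diag n ?d)" "k < dim_col (fourier_mat n * mat_diag n ?d)"
  then have jk: "j < n" "k < n"
    by (auto simp: fourier_mat_def)
  define p where "p = (if j = n - 1 then 0 else j + 1)"
  let ?w = "fourier_root n k"
  have p: "p < n" "p \<noteq> j"
    using jk n by (auto simp: p_def)
  have pw: "?w ^ p = ?w * ?w ^ j"
  proof (cases "j = n - 1")
    case True
    then have "?w * ?w ^ j = ?w ^ n"
      using n by (simp flip: power_Suc)
    then show ?thesis
      using True n by (simp add: p_def fourier_root_power)
  qed (simp add: p_def)
  \<comment> \<open>The entry condition of \<open>diff_per_mat\<close> is inverted: \<open>j\<close>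
    precedes \<open>i\<close> cyclically exactly when \<open>i\<close> is the successor
    \<open>p\<close> of \<open>j\<close>.\<close>
  have e: "j = (if i = 0 then n - 1 else i - 1) \<longleftrightarrow> i = p" if "i < n" for i
    using that jk n by (auto simp: p_def)
  have "(transpose_mat (complex_mat (diff_per_mat n)) * fourier_mat n) $$ (j, k)
      = (\<Sum>i<n. complex_of_real (if j = i then real n else if i = p then - real n else 0) * fourier_mat n $$ (i, k))"
    using jk carrier_matD[OF fourier_mat_carrier[of n]]
    by (auto simp: diff_per_mat_def scalar_prod_def lessThan_atLeast0 e intro!: sum.cong)
  also have "\<dots> = (\<Sum>i<n. (if i = j then of_nat n * fourier_mat n $$ (i, k) else 0)
      + (if i = p then - of_nat n * fourier_mat n $$ (i, k) else 0))"
    using p by (intro sum.cong) auto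
  also have "\<dots> = of_nat n * (fourier_mat n $$ (j, k) - fourier_mat n $$ (p, k))"
    using jk p by (simp add: sum.distrib algebra_simps)
  also have "\<dots> = (fourier_mat n * mat_diag n ?d) $$ (j, k)"
    using jk p by (simp add: mat_diag_mult_right[OF fourier_mat_carrier] index_fourier_mat pw algebra_simps)
  finally show "(transpose_mat (complex_mat (diff_per_mat n)) * fourier_mat n) $$ (j, k)
      = (fourier_mat n * mat_diag n ?d) $$ (j, k)" .
qed (auto simp: fourier_mat_def diff_per_mat_def)

lemma diagonalised_product:
  fixes A B V V' :: "'a::comm_ring_1 mat"
  assumes A: "A \<in> carrier_mat n n" and B: "B \<in> carrier_mat n n"
    and V: "V \<in> carrier_mat n n" "V' \<in> carrier_mat n n" "V * V' = 1\<^sub>m n"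
    and AV: "A * V = V * mat_diag n f" and BV: "B * V = V * mat_diag n g"
  shows "A * B = V * mat_diag n (\<lambda>i. f i * g i) * V'"
proof (rule eq_diagonalised[OF mult_carrier_mat[OF A B] V])
  have "A * B * V = (A * V) * mat_diag n g"
    using assoc_mult_mat[OF A B V(1)] assoc_mult_mat[OF A V(1) mat_diag_dim] BV by simp
  also have "\<dots> = V * mat_diag n (\<lambda>i. f i * g i)"
    unfolding AV using assoc_mult_mat[OF V(1) mat_diag_dim mat_diag_dim] by simp
  finally show "A * B * V = V * mat_diag n (\<lambda>i. f i * g i)" .
qed

text \<open>The periodic difference matrix and its transpose share the Fourier basis, with conjugate
  eigenvalues. So both Gram matrices coincide and have the squared moduli as eigenvalues.\<close>

lemma fourier_mat_diagonalises:
  fixes n defines "D \<equiv> complex_mat (diff_per_mat n)"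
  defines "L \<equiv> mat_diag n (\<lambda>k. complex_of_real ((real n)\<^sup>2 * (4 * (sin (real k * pi / real n))\<^sup>2)))"
  assumes n: "n \<ge> 2"
  shows "D * transpose_mat D = fourier_mat n * L * map_mat cnj (fourier_mat n)"
    and "transpose_mat D * D = fourier_mat n * L * map_mat cnj (fourier_mat n)"
proof -
  have D: "D \<in> carrier_mat n n" "transpose_mat D \<in> carrier_mat n n"
    by (simp_all add: D_def)
  have eq: "of_nat n * (1 - cnj (fourier_root n k)) * (of_nat n * (1 - fourier_root n k))
      = complex_of_real ((real n)\<^sup>2 * (4 * (sin (real k * pi / real n))\<^sup>2))" for k
  proof -
    have *: "complex_of_real ((real n)\<^sup>2 * x) = of_nat n * of_nat n * complex_of_real x" for x
      by (simp add: power2_eq_square)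
    show ?thesis
      unfolding * fourier_root_eigenvalue[symmetric] by (simp only: ac_simps)
  qed
  have F: "map_mat cnj (fourier_mat n) \<in> carrier_mat n n"
    by simp
  note prod = diagonalised_product[OF _ _ fourier_mat_carrier F fourier_mat_unitary[OF n]]
  note DF = diff_per_mat_mult_fourier[OF n, folded D_def]
    transpose_diff_per_mat_mult_fourier[OF n, folded D_def]
  show "D * transpose_mat D = fourier_mat n * L * map_mat cnj (fourier_mat n)"
    using prod[OF D DF] unfolding eq L_def .
  show "transpose_mat D * D = fourier_mat n * L * map_mat cnj (fourier_mat n)"
    using prod[OF D(2,1) DF(2,1)] unfolding mult.commute[of "of_nat n * (1 - fourier_root n _)"] eq L_def .
qed

subsection \<open>The inverse\<close>

text \<open>A result \<open>Some\<close> of \<open>mat_inverse\<close> asserts invertibility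
  together with the value of the inverse. The periodic part is stated over the complex numbers
  because the Fourier matrix is complex.\<close>

theorem proposition6:
  fixes N P :: nat and lam tau :: real
  assumes "N \<ge> 2" and "P \<ge> 2" and "lam > 0" and "tau > 0"
  shows
    "(let Df = transpose_mat (diff_mat P) \<otimes>\<^sub>m 1\<^sub>m N;
          Dm = 1\<^sub>m P \<otimes>\<^sub>m transpose_mat (diff_mat N);
          A = beside_mat Dm Df;
          Y = lam \<cdot>\<^sub>m (transpose_mat (diff_mat P) \<otimes>\<^sub>m diff_mat N);
          Xi = 1\<^sub>m P \<otimes>\<^sub>m
            (sine_mat N
             * inv_mat (diag_of_vec (shift_vec (1 / tau) (lam * (real N)\<^sup>2 \<cdot>\<^sub>v d_zero N)))
             * sine_mat N);
          Si = (sine_mat P \<otimes>\<^sub>m transpose_mat (cosine_mat N))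
             * inv_mat (diag_of_vec (shift_vec (1 / tau)
                 ((lam * (real P)\<^sup>2 \<cdot>\<^sub>v d_zero P)
                  \<otimes>\<^sub>v inv_vec (shift_vec 1 (tau * lam * (real N)\<^sup>2 \<cdot>\<^sub>v d_mirr N)))))
             * (sine_mat P \<otimes>\<^sub>m cosine_mat N)
      in mat_inverse (lam \<cdot>\<^sub>m (transpose_mat A * A) + (1 / tau) \<cdot>\<^sub>m 1\<^sub>m (dim_col A))
           = Some (block_product Xi Y Si))
     \<and>
     (let Df = transpose_mat (diff_mat P) \<otimes>\<^sub>m 1\<^sub>m N;
          Dm = 1\<^sub>m P \<otimes>\<^sub>m transpose_mat (diff_per_mat N);
          A = beside_mat Dm Df;
          Y = lam \<cdot>\<^sub>m (transpose_mat (diff_mat P) \<otimes>\<^sub>m diff_per_mat N);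
          Xi = 1\<^sub>m P \<otimes>\<^sub>m
            (fourier_mat N
             * complex_mat (inv_mat (diag_of_vec
                 (shift_vec (1 / tau) (lam * (real N)\<^sup>2 \<cdot>\<^sub>v d_per N))))
             * map_mat cnj (fourier_mat N));
          Si = (complex_mat (sine_mat P) \<otimes>\<^sub>m fourier_mat N)
             * complex_mat (inv_mat (diag_of_vec (shift_vec (1 / tau)
                 ((lam * (real P)\<^sup>2 \<cdot>\<^sub>v d_zero P)
                  \<otimes>\<^sub>v inv_vec (shift_vec 1 (tau * lam * (real N)\<^sup>2 \<cdot>\<^sub>v d_per N))))))
             * (complex_mat (sine_mat P) \<otimes>\<^sub>m map_mat cnj (fourier_mat N))
      in mat_inverse
             (complex_mat (lam \<cdot>\<^sub>m (transpose_mat A * A) + (1 / tau) \<cdot>\<^sub>m 1\<^sub>m (dim_col A)))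
           = Some (block_product Xi (complex_mat Y) Si))"
proof -
  \<comment> \<open>\<open>nu\<close>, \<open>mu\<close> and \<open>om\<close> are the eigenvalues
    for Dirichlet, Neumann and periodic boundary, including the squared size; \<open>nu\<close>
    takes the size as an argument because it is needed for both \<open>N\<close> and
    \<open>P\<close>.\<close>
  define nu where "nu n k = (real n)\<^sup>2 * (4 * (sin (real (k + 1) * pi / (2 * real n)))\<^sup>2)" for n k
  define mu where "mu k = (real N)\<^sup>2 * (4 * (sin (real k * pi / (2 * real N)))\<^sup>2)" for k
  define om where "om k = (real N)\<^sup>2 * (4 * (sin (real k * pi / real N))\<^sup>2)" for k
  have nonneg: "nu n k \<ge> 0" "mu k \<ge> 0" "om k \<ge> 0" for n k
    by (simp_all add: nu_def mu_def om_def)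
  \<comment> \<open>Positivity of \<open>lam\<close> and \<open>tau\<close> and nonnegative
    eigenvalues make every shifted diagonal entry invertible.\<close>
  have pos1: "1 / tau + lam * x > 0" "1 + tau * lam * x > 0" if "x \<ge> 0" for x
    using assms that by (simp_all add: add_pos_nonneg)
  have pos2: "1 / tau + lam * (x * inverse (1 + tau * lam * y)) > 0" if "x \<ge> 0" "y \<ge> 0" for x y
    using pos1(1)[of "x * inverse (1 + tau * lam * y)"] pos1(2)[OF that(2)] that by simp
  have Xd: "inv_mat (diag_of_vec (shift_vec (1 / tau) (lam * (real N)\<^sup>2 \<cdot>\<^sub>v d_zero N)))
      = mat_diag (N - 1) (\<lambda>i. inverse (1 / tau + lam * nu N i))"
    using pos1(1)[OF nonneg(1)]
    by (intro inv_mat_shifted_diag) (auto simp: d_zero_def nu_def less_imp_neq[symmetric])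
  have Xp: "inv_mat (diag_of_vec (shift_vec (1 / tau) (lam * (real N)\<^sup>2 \<cdot>\<^sub>v d_per N)))
      = mat_diag N (\<lambda>i. inverse (1 / tau + lam * om i))"
    using pos1(1)[OF nonneg(3)]
    by (intro inv_mat_shifted_diag) (auto simp: d_per_def om_def less_imp_neq[symmetric])
  \<comment> \<open>Stated for a general \<open>d\<close>, to cover \<open>d_mirr\<close> and
    \<open>d_per\<close> at once.\<close>
  have S: "inv_mat (diag_of_vec (shift_vec (1 / tau)
        ((lam * (real P)\<^sup>2 \<cdot>\<^sub>v d_zero P) \<otimes>\<^sub>v inv_vec (shift_vec 1 (tau * lam * (real N)\<^sup>2 \<cdot>\<^sub>v d)))))
      = mat_diag ((P - 1) * N)
          (\<lambda>i. inverse (1 / tau + lam * (nu P (i div N) * inverse (1 + tau * lam * f (i mod N)))))"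
    if "dim_vec d = N" "\<forall>i<N. (real N)\<^sup>2 * d $ i = f i" "\<And>i. f i \<ge> 0" for d f
  proof (rule inv_mat_shifted_diag)
    fix i
    assume i: "i < (P - 1) * N"
    then have "i div N < P - 1" "i mod N < N"
      using div_mult_less[OF i] mod_mult_less[OF i] by auto
    then show "((lam * (real P)\<^sup>2 \<cdot>\<^sub>v d_zero P) \<otimes>\<^sub>v inv_vec (shift_vec 1 (tau * lam * (real N)\<^sup>2 \<cdot>\<^sub>v d))) $ i
        = lam * (nu P (i div N) * inverse (1 + tau * lam * f (i mod N)))"
      using i that(1) that(2)[rule_format, of "i mod N", symmetric]
      by (simp add: kron_vec_def inv_vec_def shift_vec_def d_zero_def nu_def mult.assoc)
    show "1 / tau + lam * (nu P (i div N) * inverse (1 + tau * lam * f (i mod N))) \<noteq> 0"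
      using pos2[OF nonneg(1) that(3)] by (simp add: less_imp_neq[symmetric])
  qed (use that(1) in \<open>simp add: kron_vec_def inv_vec_def shift_vec_def d_zero_def\<close>)
  have dims: "dim_vec (d_mirr N) = N" "dim_vec (d_per N) = N"
    by (simp_all add: d_mirr_def d_per_def)
  have vals: "\<forall>i<N. (real N)\<^sup>2 * d_mirr N $ i = mu i" "\<forall>i<N. (real N)\<^sup>2 * d_per N $ i = om i"
    by (simp_all add: d_mirr_def d_per_def mu_def om_def)
  note Sd = S[OF dims(1) vals(1) nonneg(2)] and Sp = S[OF dims(2) vals(2) nonneg(3)]
  let ?D = "diff_mat N" and ?E = "diff_mat P"
  let ?c = complex_of_real
  have CC: "transpose_mat (cosine_mat N) * cosine_mat N = 1\<^sub>m N"
    by (rule mat_mult_left_right_inverse[OF _ _ cosine_mat_orthogonal[OF assms(1)]]) auto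
  have tau: "tau \<noteq> 0" "?c tau \<noteq> 0"
    using assms by auto
  have mirror: "mat_inverse (lam \<cdot>\<^sub>m (transpose_mat A * A) + (1 / tau) \<cdot>\<^sub>m 1\<^sub>m (dim_col A))
    = Some (block_product
        (1\<^sub>m P \<otimes>\<^sub>m (sine_mat N * mat_diag (N - 1) (\<lambda>i. inverse (1 / tau + lam * nu N i)) * sine_mat N))
        (lam \<cdot>\<^sub>m (transpose_mat ?E \<otimes>\<^sub>m ?D))
        ((sine_mat P \<otimes>\<^sub>m transpose_mat (cosine_mat N)) * mat_diag ((P - 1) * N) (\<lambda>i. inverse (1 / tau
             + lam * (nu P (i div N) * inverse (1 + tau * lam * mu (i mod N)))))
          * (sine_mat P \<otimes>\<^sub>m cosine_mat N)))"
    if "A = beside_mat (1\<^sub>m P \<otimes>\<^sub>m transpose_mat ?D) (transpose_mat ?E \<otimes>\<^sub>m 1\<^sub>m N)" for A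
    by (rule mat_inverse_block_product[OF diff_mat_carrier diff_mat_carrier tau(1)
          sine_mat_carrier sine_mat_carrier sine_mat_square[OF assms(2)]
          sine_mat_carrier sine_mat_carrier sine_mat_square[OF assms(1)]
          _ cosine_mat_carrier CC
          sine_mat_diagonalises[OF assms(2), folded nu_def] sine_mat_diagonalises[OF assms(1), folded nu_def]
          cosine_mat_diagonalises[OF assms(1), folded mu_def] _ _ _ that])
       (use pos1 pos2 nonneg in \<open>auto simp: less_imp_neq[symmetric]\<close>)
  let ?D' = "complex_mat (diff_per_mat N)" and ?E' = "complex_mat (diff_mat P)"
  let ?S = "complex_mat (sine_mat P)" and ?F = "fourier_mat N" and ?F' = "map_mat cnj (fourier_mat N)"
  have dim_eq: "dim_col (sine_mat P) = dim_row (sine_mat P)" "dim_row (sine_mat P) = P - 1"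
    by (simp_all add: sine_mat_def)
  have SS: "?S * ?S = 1\<^sub>m (P - 1)"
    unfolding complex_mat_mult[OF dim_eq(1), symmetric] sine_mat_square[OF assms(2)]
    by (rule of_real_hom.mat_hom_one)
  \<comment> \<open>The sine diagonalisation for \<open>P\<close> is carried over to complex
    entries, since \<open>mat_inverse_block_product\<close> needs all bases over one field.\<close>
  have EE: "?E' * transpose_mat ?E' = ?S * mat_diag (P - 1) (\<lambda>i. ?c (nu P i)) * ?S"
  proof -
    let ?L = "mat_diag (P - 1) (nu P)"
    have "?E' * transpose_mat ?E' = complex_mat (sine_mat P * ?L * sine_mat P)"
      by (simp only: map_mat_transpose complex_mat_mult[symmetric] index_transpose_mat
          sine_mat_diagonalises[OF assms(2), folded nu_def])
    also have "\<dots> = ?S * complex_mat ?L * ?S"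
      using of_real_hom.mat_hom_mult[OF sine_mat_carrier mat_diag_dim]
        of_real_hom.mat_hom_mult[OF mult_carrier_mat[OF sine_mat_carrier mat_diag_dim] sine_mat_carrier]
      by metis
    finally show ?thesis
      unfolding complex_mat_diag .
  qed
  have nz: "1 / ?c tau + ?c lam * ?c x \<noteq> 0" "1 + ?c tau * ?c lam * ?c x \<noteq> 0" if "x \<ge> 0" for x
    using pos1[OF that, THEN less_imp_neq, THEN not_sym, folded of_real_eq_0_iff[where 'a = complex]]
    by simp_all
  have nz2: "1 / ?c tau + ?c lam * (?c x * inverse (1 + ?c tau * ?c lam * ?c y)) \<noteq> 0"
    if "x \<ge> 0" "y \<ge> 0" for x y
    using pos2[OF that, THEN less_imp_neq, THEN not_sym, folded of_real_eq_0_iff[where 'a = complex]]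
    by simp
  have periodic: "mat_inverse (?c lam \<cdot>\<^sub>m (transpose_mat A * A) + (1 / ?c tau) \<cdot>\<^sub>m 1\<^sub>m (dim_col A))
    = Some (block_product
        (1\<^sub>m P \<otimes>\<^sub>m (?F * mat_diag N (\<lambda>i. inverse (1 / ?c tau + ?c lam * ?c (om i))) * ?F'))
        (?c lam \<cdot>\<^sub>m (transpose_mat ?E' \<otimes>\<^sub>m ?D'))
        ((?S \<otimes>\<^sub>m ?F) * mat_diag ((P - 1) * N) (\<lambda>i. inverse (1 / ?c tau
             + ?c lam * (?c (nu P (i div N)) * inverse (1 + ?c tau * ?c lam * ?c (om (i mod N))))))
          * (?S \<otimes>\<^sub>m ?F')))"
    if "A = beside_mat (1\<^sub>m P \<otimes>\<^sub>m transpose_mat ?D') (transpose_mat ?E' \<otimes>\<^sub>m 1\<^sub>m N)" for A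
    by (rule mat_inverse_block_product[OF _ _ tau(2) _ _ SS _ _ fourier_mat_unitary[OF assms(1)]
          _ _ fourier_mat_unitary[OF assms(1)] EE
          fourier_mat_diagonalises[OF assms(1), folded om_def] _ _ _ that])
       (use nz nz2 nonneg in auto)
  show ?thesis
    unfolding Let_def Xd Xp Sd Sp
  proof (rule conjI[OF mirror[OF refl]])
    let ?A = "beside_mat (1\<^sub>m P \<otimes>\<^sub>m transpose_mat (diff_per_mat N)) (transpose_mat ?E \<otimes>\<^sub>m 1\<^sub>m N)"
    have A: "complex_mat ?A
        = beside_mat (1\<^sub>m P \<otimes>\<^sub>m transpose_mat ?D') (transpose_mat ?E' \<otimes>\<^sub>m 1\<^sub>m N)"
      using carrier_matD(2)[OF diff_per_mat_carrier[of N]] carrier_matD(2)[OF diff_mat_carrier[of P]]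
      by (simp add: complex_mat_beside complex_mat_kron map_mat_transpose[symmetric] of_real_hom.mat_hom_one)
    \<comment> \<open>The embedding commutes with all matrix operations involved, which brings the
      real system matrix into the form handled by \<open>periodic\<close>.\<close>
    have "complex_mat (lam \<cdot>\<^sub>m (transpose_mat ?A * ?A) + (1 / tau) \<cdot>\<^sub>m 1\<^sub>m (dim_col ?A))
        = ?c lam \<cdot>\<^sub>m (transpose_mat (complex_mat ?A) * complex_mat ?A)
          + (1 / ?c tau) \<cdot>\<^sub>m 1\<^sub>m (dim_col (complex_mat ?A))"
      by (simp add: complex_mat_add complex_mat_smult complex_mat_mult map_mat_transpose[symmetric] of_real_hom.mat_hom_one)
    moreover have "complex_mat (lam \<cdot>\<^sub>m (transpose_mat ?E \<otimes>\<^sub>m diff_per_mat N))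
        = ?c lam \<cdot>\<^sub>m (transpose_mat ?E' \<otimes>\<^sub>m ?D')"
      by (simp add: complex_mat_smult complex_mat_kron map_mat_transpose[symmetric])
    ultimately show "mat_inverse (complex_mat (lam \<cdot>\<^sub>m (transpose_mat ?A * ?A) + (1 / tau) \<cdot>\<^sub>m 1\<^sub>m (dim_col ?A)))
        = Some (block_product
        (1\<^sub>m P \<otimes>\<^sub>m (?F * complex_mat (mat_diag N (\<lambda>i. inverse (1 / tau + lam * om i))) * ?F'))
        (complex_mat (lam \<cdot>\<^sub>m (transpose_mat ?E \<otimes>\<^sub>m diff_per_mat N)))
        ((?S \<otimes>\<^sub>m ?F) * complex_mat (mat_diag ((P - 1) * N) (\<lambda>i. inverse (1 / tau
             + lam * (nu P (i div N) * inverse (1 + tau * lam * om (i mod N))))))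
          * (?S \<otimes>\<^sub>m ?F')))"
      using periodic[OF A] by (simp only: complex_mat_diag of_real_add of_real_mult of_real_inverse of_real_divide of_real_1)
  qed
qed

end
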